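(* Let $n$ be a positive integer, let $a_i,b_i,c_i,d_i$ ($1\le i\le n$) be positive real numbers, and let $A$ be the $4\times 2n$ matrix $$A=\begin{bmatrix}a_1&b_1&a_2&b_2&\cdots&a_n&b_n\\ a_1&b_1&a_2&b_2&\cdots&a_n&b_n\\ c_1&d_1&c_2&d_2&\cdots&c_n&d_n\\ c_1&d_1&c_2&d_2&\cdots&c_n&d_n\end{bmatrix}.$$ (a) If $n=2k$, then $$\operatorname{M}(AD_n(\operatorname{wt}_A))=2^{k(k+1)}\prod_{i=1}^{k}(a_ib_{n-i+1}c_id_{n-i+1})^{k-i+1}\ \prod_{j=1}^{k}\prod_{i=j}^{n-j}(d_ia_{i+1}+b_ic_{i+1}).$$ (b) If $n=2k+1$, then $$\operatorname{M}(AD_n(\operatorname{wt}_A))=2^{(k+1)^2}\prod_{i=1}^{k+1}(a_ib_{n-i+1})^{k-i+2}(c_id_{n-i+1})^{k-i+1}\ \prod_{j=1}^{k}\prod_{i=j}^{n-j}(d_ia_{i+1}+b_ic_{i+1}).$$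
   Context: For an edge-weighted finite graph $G$, $\operatorname{M}(G)$ is the sum over all perfect matchings of $G$ of the product of the weights of the edges of the matching. The Aztec diamond graph $AD_n$ of order $n\ge1$ has vertices $u_{i,j}$ ($1\le i\le n+1$, $1\le j\le n$) and $v_{i,j}$ ($1\le i\le n$, $1\le j\le n+1$), and edges $e_{r,c}$ ($1\le r,c\le 2n$), where $e_{r,c}$ joins $u_{\lfloor r/2\rfloor+1,\lceil c/2\rceil}$ and $v_{\lceil r/2\rceil,\lfloor c/2\rfloor+1}$. (The edge centres form a $2n\times2n$ array, and each aligned $2\times2$ block of the array consists of the four edges of a 4-cycle.) For a $k\times l$ matrix $A$ with $k,l$ even, $AD_n(\operatorname{wt}_A)$ is $AD_n$ with edge $e_{r,c}$ given the weight $A_{r',c'}$, where $1\le r'\le k$, $1\le c'\le l$, $r'\equiv r \pmod k$, $c'\equiv c\pmod l$. *)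

theory Defs
  imports Complex_Main "Jordan_Normal_Form.Matrix"
begin

text \<open>
  Edges are abstract names, each with the set of its two end vertices. This lets the edges of the
  Aztec diamond be addressed by their position in the \<open>2n \<times> 2n\<close> array of edge centres.
\<close>

record ('v, 'e, 'w) weighted_graph =
  verts :: "'v set"
  edges :: "'e set"
  ends :: "'e \<Rightarrow> 'v set"
  wt :: "'e \<Rightarrow> 'w"

definition perfect_matchings :: "('v, 'e, 'w) weighted_graph \<Rightarrow> 'e set set" where
  "perfect_matchings G =
     {X. X \<subseteq> edges G \<and> (\<forall>v \<in> verts G. \<exists>!e. e \<in> X \<and> v \<in> ends G e)}"

definition matching_sum :: "('v, 'e, 'w :: comm_semiring_1) weighted_graph \<Rightarrow> 'w" where
  "matching_sum G = (\<Sum>X \<in> perfect_matchings G. \<Prod>e \<in> X. wt G e)"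

datatype aztec_vertex = U nat nat | V nat nat

definition aztec_verts :: "nat \<Rightarrow> aztec_vertex set" where
  "aztec_verts n =
     {U i j | i j. i \<in> {1..n + 1} \<and> j \<in> {1..n}} \<union> {V i j | i j. i \<in> {1..n} \<and> j \<in> {1..n + 1}}"

definition aztec_edges :: "nat \<Rightarrow> (nat \<times> nat) set" where
  "aztec_edges n = {1..2 * n} \<times> {1..2 * n}"

text \<open>On naturals, \<open>\<lfloor>x/2\<rfloor>\<close> is \<open>x div 2\<close> and \<open>\<lceil>x/2\<rceil>\<close> is \<open>(x + 1) div 2\<close>.\<close>

fun aztec_ends :: "nat \<times> nat \<Rightarrow> aztec_vertex set" where
  "aztec_ends (r, s) =
     {U (r div 2 + 1) ((s + 1) div 2), V ((r + 1) div 2) (s div 2 + 1)}"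

text \<open>
  Edge positions count from 1, whereas matrix indices of type \<open>mat\<close> count from 0; hence the
  shift by one before reducing modulo the dimensions.
\<close>

fun periodic_weight :: "'w mat \<Rightarrow> nat \<times> nat \<Rightarrow> 'w" where
  "periodic_weight A (r, s) = A $$ ((r - 1) mod dim_row A, (s - 1) mod dim_col A)"

definition aztec_diamond ::
    "nat \<Rightarrow> 'w mat \<Rightarrow> (aztec_vertex, nat \<times> nat, 'w) weighted_graph" where
  "aztec_diamond n A =
     \<lparr>verts = aztec_verts n, edges = aztec_edges n, ends = aztec_ends, wt = periodic_weight A\<rparr>"

text \<open>
  The \<open>4 \<times> 2n\<close> matrix with rows \<open>a\<^sub>1 b\<^sub>1 \<dots> a\<^sub>n b\<^sub>n\<close> (twice) and \<open>c\<^sub>1 d\<^sub>1 \<dots> c\<^sub>n d\<^sub>n\<close> (twice); the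
  sequences are indexed from 1, the matrix from 0.
\<close>

definition weight_matrix ::
    "nat \<Rightarrow> (nat \<Rightarrow> 'w) \<Rightarrow> (nat \<Rightarrow> 'w) \<Rightarrow> (nat \<Rightarrow> 'w) \<Rightarrow> (nat \<Rightarrow> 'w) \<Rightarrow> 'w mat" where
  "weight_matrix n a b c d = mat 4 (2 * n) (\<lambda>(r, s).
     if r < 2 then (if even s then a (s div 2 + 1) else b (s div 2 + 1))
     else (if even s then c (s div 2 + 1) else d (s div 2 + 1)))"

text \<open>Sanity check: the Aztec diamond is a simple graph, without loops or parallel edges.\<close>

lemma aztec_ends_in_verts: "e \<in> aztec_edges n \<Longrightarrow> aztec_ends e \<subseteq> aztec_verts n"
  by (cases e) (auto simp: aztec_edges_def aztec_verts_def)

lemma inj_aztec_ends: "inj aztec_ends"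
proof (rule injI)
  fix e e' :: "nat \<times> nat"
  assume *: "aztec_ends e = aztec_ends e'"
  obtain r s r' s' where e: "e = (r, s)" "e' = (r', s')"
    by (cases e, cases e')
  have "r div 2 = r' div 2" "(r + 1) div 2 = (r' + 1) div 2"
       "s div 2 = s' div 2" "(s + 1) div 2 = (s' + 1) div 2"
    using * by (simp_all add: e doubleton_eq_iff)
  moreover have "x div 2 + (x + 1) div 2 = x" for x :: nat
    by simp
  ultimately have "r = r'" "s = s'"
    by metis+
  then show "e = e'"
    by (simp add: e)
qed

end

theory Submission
  imports Defs "HOL-Library.FuncSet"
begin

text \<open>
  The proof is urban renewal on all cells at once. Every vertex of a perfect matching is matched
  inside exactly one of the \<open>2 \<times> 2\<close> blocks (cells, 4-cycles) containing it, so the matching sum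
  is a sum over assignments of the vertices to cells of products of local matching sums. If
  \<open>\<Delta>\<close> is the sum of the weights of the two perfect matchings of a cell, the local sum of a vertex set \<open>S\<close> equals \<open>\<Delta>\<close> times the
  local sum of the complement of \<open>S\<close>, once the weight of each edge is replaced by the weight of the
  opposite edge over \<open>\<Delta>\<close>. Since an inner vertex lies in two cells and a boundary vertex in one,
  complementing an assignment moves each inner vertex to its other cell and deletes the boundary:
  the order drops by one. After two such steps the weights have the original four-row shape again,
  with
  \<open>a'\<^sub>i = 1/(2 b\<^sub>i \<Delta>\<^sub>i)\<close>, \<open>b'\<^sub>i = 1/(2 a\<^sub>i\<^sub>+\<^sub>2 \<Delta>\<^sub>i\<^sub>+\<^sub>1)\<close>, \<open>c'\<^sub>i = 1/(2 d\<^sub>i \<Delta>\<^sub>i)\<close>, \<open>d'\<^sub>i = 1/(2 c\<^sub>i\<^sub>+\<^sub>2 \<Delta>\<^sub>i\<^sub>+\<^sub>1)\<close>, where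
  \<open>\<Delta>\<^sub>i = 1/(4 b\<^sub>i c\<^sub>i\<^sub>+\<^sub>1) + 1/(4 a\<^sub>i\<^sub>+\<^sub>1 d\<^sub>i)\<close>, and the product formula follows by induction.
\<close>

section \<open>Matching sums by cells\<close>

text \<open>The union equation makes \<open>S\<close> exactly the set of matched vertices. Edges
  sticking out of \<open>S\<close> are thereby excluded, and \<open>Y\<close> determines
  \<open>S\<close>.\<close>

definition exact_cover :: "('e \<Rightarrow> 'v set) \<Rightarrow> 'e set \<Rightarrow> 'v set \<Rightarrow> bool" where
  "exact_cover f Y S \<longleftrightarrow> (\<Union>e\<in>Y. f e) = S \<and> (\<forall>v\<in>S. \<exists>!e. e \<in> Y \<and> v \<in> f e)"

definition cell_sum ::
    "('e \<Rightarrow> 'v set) \<Rightarrow> ('e \<Rightarrow> 'w :: comm_semiring_1) \<Rightarrow> 'e set \<Rightarrow> 'v set \<Rightarrow> 'w" where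
  "cell_sum f w E S = (\<Sum>Y \<in> {Y \<in> Pow E. exact_cover f Y S}. \<Prod>e\<in>Y. w e)"

definition cell_assignments :: "'c set \<Rightarrow> ('c \<Rightarrow> 'v set) \<Rightarrow> 'v set \<Rightarrow> ('c \<Rightarrow> 'v set) set" where
  "cell_assignments C Vc W =
     {\<sigma> \<in> PiE C (\<lambda>c. Pow (Vc c)). \<forall>v\<in>W. \<exists>!c. c \<in> C \<and> v \<in> \<sigma> c}"

text \<open>A perfect matching \<open>X\<close> corresponds to the pair of its traces
  \<open>X \<inter> E c\<close> and the vertex sets these traces cover. Conversely, exact covers
  chosen cell by cell glue to a perfect matching, because each vertex is assigned to one cell only.
  Distributing the product over the local sums gives the right-hand side.\<close>

lemma matching_sum_cells:
  fixes G :: "('v, 'e, 'w :: comm_semiring_1) weighted_graph" and C :: "'c set"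
  assumes C: "finite C" and E: "\<And>c. c \<in> C \<Longrightarrow> finite (E c)"
    and disj: "\<And>c c'. c \<in> C \<Longrightarrow> c' \<in> C \<Longrightarrow> c \<noteq> c' \<Longrightarrow> E c \<inter> E c' = {}"
    and edges: "edges G = (\<Union>c\<in>C. E c)"
    and ends: "\<And>c e. c \<in> C \<Longrightarrow> e \<in> E c \<Longrightarrow> ends G e \<subseteq> Vc c"
    and Vc: "\<And>c. c \<in> C \<Longrightarrow> finite (Vc c)" "\<And>c. c \<in> C \<Longrightarrow> Vc c \<subseteq> verts G"
  shows "matching_sum G =
    (\<Sum>\<sigma> \<in> cell_assignments C Vc (verts G). \<Prod>c\<in>C. cell_sum (ends G) (wt G) (E c) (\<sigma> c))"
proof -
  let ?f = "ends G" and ?\<Sigma> = "cell_assignments C Vc (verts G)"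
  define A where "A S c = {Y \<in> Pow (E c). exact_cover ?f Y S}" for S c
  have finA: "finite (A S c)" if "c \<in> C" for S c
    using E[OF that] by (simp add: A_def)
  have fin\<Sigma>: "finite ?\<Sigma>"
    using C Vc by (intro finite_subset[OF _ finite_PiE[of C "\<lambda>c. Pow (Vc c)"]])
      (auto simp: cell_assignments_def)
  let ?T = "Sigma ?\<Sigma> (\<lambda>\<sigma>. PiE C (\<lambda>c. A (\<sigma> c) c))"
  let ?j = "\<lambda>X. (\<lambda>c\<in>C. \<Union>e\<in>X \<inter> E c. ?f e, \<lambda>c\<in>C. X \<inter> E c)"
  let ?i = "\<lambda>x :: ('c \<Rightarrow> 'v set) \<times> ('c \<Rightarrow> 'e set). \<Union>c\<in>C. snd x c"
  have "(\<Sum>\<sigma> \<in> ?\<Sigma>. \<Prod>c\<in>C. cell_sum ?f (wt G) (E c) (\<sigma> c)) =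
      (\<Sum>\<sigma> \<in> ?\<Sigma>. \<Prod>c\<in>C. \<Sum>Y\<in>A (\<sigma> c) c. \<Prod>e\<in>Y. wt G e)"
    by (simp add: cell_sum_def A_def)
  also have "\<dots> = (\<Sum>\<sigma> \<in> ?\<Sigma>. \<Sum>\<tau>\<in>PiE C (\<lambda>c. A (\<sigma> c) c). \<Prod>c\<in>C. \<Prod>e\<in>\<tau> c. wt G e)"
    using C finA by (intro sum.cong prod_sum_PiE) auto
  also have "\<dots> = (\<Sum>x\<in>?T. \<Prod>c\<in>C. \<Prod>e\<in>snd x c. wt G e)"
    using C finA fin\<Sigma> by (subst sum.Sigma) (auto intro!: finite_PiE simp: case_prod_unfold)
  also have "\<dots> = (\<Sum>X \<in> perfect_matchings G. \<Prod>e\<in>X. wt G e)"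
  proof (rule sym, rule sum.reindex_bij_witness[where i = ?i and j = ?j])
    fix X assume X: "X \<in> perfect_matchings G"
    then have sub: "X \<subseteq> (\<Union>c\<in>C. E c)" and ex: "\<And>v. v \<in> verts G \<Longrightarrow> \<exists>!e. e \<in> X \<and> v \<in> ?f e"
      by (auto simp: perfect_matchings_def edges)
    show "?i (?j X) = X"
      using sub by auto
    have "exact_cover ?f (X \<inter> E c) (\<Union>e\<in>X \<inter> E c. ?f e)" if "c \<in> C" for c
      unfolding exact_cover_def
    proof (intro conjI ballI refl)
      fix v assume v: "v \<in> (\<Union>e\<in>X \<inter> E c. ?f e)"
      then have "v \<in> verts G"
        using ends[OF that] Vc(2)[OF that] by blast
      from ex[OF this] v show "\<exists>!e. e \<in> X \<inter> E c \<and> v \<in> ?f e"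
        by blast
    qed
    moreover have "\<exists>!c. c \<in> C \<and> v \<in> (\<lambda>c\<in>C. \<Union>e\<in>X \<inter> E c. ?f e) c" if v: "v \<in> verts G" for v
    proof -
      obtain e where e: "e \<in> X" "v \<in> ?f e" and un: "\<And>e'. e' \<in> X \<Longrightarrow> v \<in> ?f e' \<Longrightarrow> e' = e"
        using ex[OF v] by blast
      obtain c where c: "c \<in> C" "e \<in> E c"
        using e sub by blast
      show ?thesis
      proof (rule ex1I[of _ c])
        show "c \<in> C \<and> v \<in> (\<lambda>c\<in>C. \<Union>e\<in>X \<inter> E c. ?f e) c"
          using c e by auto
        fix c' assume c': "c' \<in> C \<and> v \<in> (\<lambda>c\<in>C. \<Union>e\<in>X \<inter> E c. ?f e) c'"
        then have "e \<in> E c'"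
          using un by auto
        then show "c' = c"
          using disj c c' by blast
      qed
    qed
    moreover have "(\<lambda>c\<in>C. \<Union>e\<in>X \<inter> E c. ?f e) \<in> PiE C (\<lambda>c. Pow (Vc c))"
      using ends by (auto simp: PiE_iff extensional_def)
    ultimately show "?j X \<in> ?T"
      by (auto simp: cell_assignments_def A_def PiE_iff)
    have "X = (\<Union>c\<in>C. X \<inter> E c)"
      using sub by auto
    then have "(\<Prod>e\<in>X. wt G e) = (\<Prod>e\<in>(\<Union>c\<in>C. X \<inter> E c). wt G e)"
      by simp
    also have "\<dots> = (\<Prod>c\<in>C. \<Prod>e\<in>X \<inter> E c. wt G e)"
      using C E disj by (intro prod.UNION_disjoint) auto
    finally show "(\<Prod>c\<in>C. \<Prod>e\<in>snd (?j X) c. wt G e) = (\<Prod>e\<in>X. wt G e)"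
      by simp
  next
    fix x assume x: "x \<in> ?T"
    obtain \<sigma> \<tau> where x_eq: "x = (\<sigma>, \<tau>)"
      by (cases x)
    from x have \<sigma>: "\<sigma> \<in> PiE C (\<lambda>c. Pow (Vc c))"
      and ex: "\<And>v. v \<in> verts G \<Longrightarrow> \<exists>!c. c \<in> C \<and> v \<in> \<sigma> c"
      and \<tau>: "\<tau> \<in> PiE C (\<lambda>c. A (\<sigma> c) c)"
      by (auto simp: x_eq cell_assignments_def)
    have \<tau>c: "\<tau> c \<subseteq> E c" "exact_cover ?f (\<tau> c) (\<sigma> c)" if "c \<in> C" for c
      using \<tau> that by (auto simp: PiE_iff A_def)
    have int: "(\<Union>c\<in>C. \<tau> c) \<inter> E c = \<tau> c" if "c \<in> C" for c
      using \<tau>c(1) disj that by blast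
    have "(\<lambda>c\<in>C. (\<Union>c\<in>C. \<tau> c) \<inter> E c) = \<tau>"
      using \<tau> int by (intro extensionalityI[where A = C]) (auto simp: PiE_iff)
    moreover have "(\<lambda>c\<in>C. \<Union>e\<in>(\<Union>c\<in>C. \<tau> c) \<inter> E c. ?f e) = \<sigma>"
    proof (rule extensionalityI[where A = C])
      show "(\<lambda>c\<in>C. \<Union>e\<in>(\<Union>c\<in>C. \<tau> c) \<inter> E c. ?f e) c = \<sigma> c" if "c \<in> C" for c
        using \<tau>c(2)[OF that] that by (simp add: int exact_cover_def)
    qed (use \<sigma> in \<open>auto simp: PiE_iff\<close>)
    ultimately show "?j (?i x) = x"
      by (simp add: x_eq)
    have "\<exists>!e. e \<in> (\<Union>c\<in>C. \<tau> c) \<and> v \<in> ?f e" if v: "v \<in> verts G" for v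
    proof -
      obtain c where c: "c \<in> C" "v \<in> \<sigma> c" and cu: "\<And>c'. c' \<in> C \<Longrightarrow> v \<in> \<sigma> c' \<Longrightarrow> c' = c"
        using ex[OF v] by blast
      have "\<exists>!e. e \<in> \<tau> c \<and> v \<in> ?f e"
        using \<tau>c(2)[OF c(1)] c(2) by (simp add: exact_cover_def)
      then obtain e where e: "e \<in> \<tau> c" "v \<in> ?f e"
        and eu: "\<And>e'. e' \<in> \<tau> c \<Longrightarrow> v \<in> ?f e' \<Longrightarrow> e' = e"
        by blast
      \<comment> \<open>An edge of \<open>\<tau> c'\<close> covers only vertices of
        \<open>\<sigma> c'\<close>, so an edge at \<open>v\<close> can come from no cell but the one
        to which \<open>v\<close> is assigned.\<close>
      have "c' = c" if "c' \<in> C" "e' \<in> \<tau> c'" "v \<in> ?f e'" for c' e'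
        using \<tau>c(2)[OF that(1)] that cu unfolding exact_cover_def by blast
      then show ?thesis
        using c e eu by blast
    qed
    moreover have "(\<Union>c\<in>C. \<tau> c) \<subseteq> (\<Union>c\<in>C. E c)"
      using \<tau>c(1) by blast
    ultimately show "?i x \<in> perfect_matchings G"
      by (simp add: x_eq perfect_matchings_def edges)
  qed
  finally show ?thesis
    by (simp add: matching_sum_def)
qed

definition interior_graph :: "('v, 'e, 'w) weighted_graph \<Rightarrow> 'v set \<Rightarrow> ('e \<Rightarrow> 'w) \<Rightarrow> ('v, 'e, 'w) weighted_graph" where
  "interior_graph G W w = \<lparr>verts = W, edges = {e \<in> edges G. ends G e \<subseteq> W}, ends = ends G, wt = w\<rparr>"

text \<open>An exact cover of \<open>S\<close> uses only edges with both ends in \<open>S\<close>,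
  so discarding the edges that leave \<open>W\<close> loses nothing. This lets the interior graph
  keep the full cells of the original graph.\<close>

lemma cell_sum_restrict:
  assumes "S \<subseteq> W"
  shows "cell_sum f w {e \<in> E. f e \<subseteq> W} S = cell_sum f w E S"
  unfolding cell_sum_def exact_cover_def using assms
  by (intro sum.cong refl arg_cong[of _ _ "\<lambda>P. {Y. P Y}"] ext) auto

text \<open>Complementing inside every cell is an involution that carries assignments of
  \<open>verts G\<close> to assignments of \<open>W\<close> and back. The local identity
  \<open>complement\<close> contributes one factor \<open>\<Delta> c\<close> per cell, independent
  of the assignment, so these factors come out of the sum.\<close>

lemma matching_sum_complement:
  fixes G :: "('v, 'e, 'w :: comm_semiring_1) weighted_graph" and C :: "'c set"
  assumes C: "finite C" and E: "\<And>c. c \<in> C \<Longrightarrow> finite (E c)"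
    and disj: "\<And>c c'. c \<in> C \<Longrightarrow> c' \<in> C \<Longrightarrow> c \<noteq> c' \<Longrightarrow> E c \<inter> E c' = {}"
    and edges: "edges G = (\<Union>c\<in>C. E c)"
    and ends: "\<And>c e. c \<in> C \<Longrightarrow> e \<in> E c \<Longrightarrow> ends G e \<subseteq> Vc c"
    and Vc: "\<And>c. c \<in> C \<Longrightarrow> finite (Vc c)" "\<And>c. c \<in> C \<Longrightarrow> Vc c \<subseteq> verts G"
    and W: "W \<subseteq> verts G"
    and inner: "\<And>v. v \<in> W \<Longrightarrow> card {c \<in> C. v \<in> Vc c} = 2"
    and outer: "\<And>v. v \<in> verts G - W \<Longrightarrow> card {c \<in> C. v \<in> Vc c} = 1"
    and complement: "\<And>c S. c \<in> C \<Longrightarrow> S \<subseteq> Vc c \<Longrightarrow>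
      cell_sum (ends G) (wt G) (E c) S = \<Delta> c * cell_sum (ends G) w (E c) (Vc c - S)"
  shows "matching_sum G = (\<Prod>c\<in>C. \<Delta> c) * matching_sum (interior_graph G W w)"
proof -
  let ?f = "ends G" and ?H = "interior_graph G W w"
  let ?A = "cell_assignments C Vc (verts G)" and ?B = "cell_assignments C (\<lambda>c. Vc c \<inter> W) W"
  let ?i = "\<lambda>\<sigma>. \<lambda>c\<in>C. Vc c - \<sigma> c"
  \<comment> \<open>Of the two cells around an inner vertex, one owns it and the complement gives it
    to the other. The claim is stated for any \<open>\<sigma>\<close> so that it serves both
    directions of the bijection.\<close>
  have twice: "\<exists>!c. c \<in> C \<and> v \<in> Vc c - \<sigma> c"
    if ex: "\<exists>!c. c \<in> C \<and> v \<in> \<sigma> c" and v: "v \<in> W" and \<sigma>: "\<And>c. c \<in> C \<Longrightarrow> \<sigma> c \<subseteq> Vc c" for \<sigma> v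
  proof -
    obtain c where c: "c \<in> C" "v \<in> \<sigma> c" and cu: "\<And>c'. c' \<in> C \<Longrightarrow> v \<in> \<sigma> c' \<Longrightarrow> c' = c"
      using ex by blast
    have "c \<in> {c \<in> C. v \<in> Vc c}"
      using c \<sigma> by blast
    moreover obtain x y where xy: "{c \<in> C. v \<in> Vc c} = {x, y}" "x \<noteq> y"
      using inner[OF v] unfolding card_2_iff by blast
    ultimately obtain z where z: "{c \<in> C. v \<in> Vc c} = {c, z}" "z \<noteq> c"
      by (metis doubleton_eq_iff insertE singletonD)
    show ?thesis
    proof (rule ex1I[of _ z])
      have "z \<in> {c \<in> C. v \<in> Vc c}"
        by (simp add: z)
      then show "z \<in> C \<and> v \<in> Vc z - \<sigma> z"
        using cu[of z] z(2) by blast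
      fix c' assume c': "c' \<in> C \<and> v \<in> Vc c' - \<sigma> c'"
      then have "c' \<in> {c, z}"
        unfolding z(1)[symmetric] by blast
      then show "c' = z"
        using c c' by blast
    qed
  qed
  have once: "\<exists>!c. c \<in> C \<and> v \<in> Vc c" if v: "v \<in> verts G - W" for v
  proof -
    obtain x where "{c \<in> C. v \<in> Vc c} = {x}"
      using outer[OF v] by (auto simp: card_1_singleton_iff)
    then show ?thesis
      by (intro ex1I[of _ x]) (auto simp: set_eq_iff)
  qed
  have "matching_sum G = (\<Sum>\<sigma> \<in> ?A. \<Prod>c\<in>C. cell_sum ?f (wt G) (E c) (\<sigma> c))"
    by (rule matching_sum_cells[OF C E disj edges ends Vc])
  also have "\<dots> = (\<Sum>\<sigma> \<in> ?A. (\<Prod>c\<in>C. \<Delta> c) * (\<Prod>c\<in>C. cell_sum ?f w (E c) (Vc c - \<sigma> c)))"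
    unfolding prod.distrib[symmetric]
    by (intro sum.cong prod.cong refl complement) (auto simp: cell_assignments_def PiE_iff)
  also have "\<dots> = (\<Prod>c\<in>C. \<Delta> c) * (\<Sum>\<sigma> \<in> ?A. \<Prod>c\<in>C. cell_sum ?f w (E c) (Vc c - \<sigma> c))"
    by (simp add: sum_distrib_left)
  also have "(\<Sum>\<sigma> \<in> ?A. \<Prod>c\<in>C. cell_sum ?f w (E c) (Vc c - \<sigma> c)) =
      (\<Sum>\<sigma> \<in> ?B. \<Prod>c\<in>C. cell_sum ?f w (E c) (\<sigma> c))"
  proof (rule sum.reindex_bij_witness[where i = ?i and j = ?i])
    fix \<sigma> assume \<sigma>A: "\<sigma> \<in> ?A"
    then have ext: "\<sigma> \<in> extensional C" and sub: "\<And>c. c \<in> C \<Longrightarrow> \<sigma> c \<subseteq> Vc c"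
      and ex: "\<And>v. v \<in> verts G \<Longrightarrow> \<exists>!c. c \<in> C \<and> v \<in> \<sigma> c"
      by (auto simp: cell_assignments_def PiE_iff)
    show "?i (?i \<sigma>) = \<sigma>"
      using ext sub by (intro extensionalityI[where A = C]) auto
    \<comment> \<open>A boundary vertex must be assigned to its only cell, so it disappears from the
      complement.\<close>
    have "v \<in> W" if "c \<in> C" "v \<in> Vc c - \<sigma> c" for c v
    proof (rule ccontr)
      assume "v \<notin> W"
      then have v: "v \<in> verts G - W"
        using that Vc by blast
      from once[OF v] ex[of v] v that sub show False
        by blast
    qed
    moreover have "\<exists>!c. c \<in> C \<and> v \<in> ?i \<sigma> c" if "v \<in> W" for v
      using twice[OF ex _ sub, of v] that W by (auto cong: conj_cong)
    ultimately show "?i \<sigma> \<in> ?B"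
      by (auto simp: cell_assignments_def PiE_iff)
    show "(\<Prod>c\<in>C. cell_sum ?f w (E c) (?i \<sigma> c)) = (\<Prod>c\<in>C. cell_sum ?f w (E c) (Vc c - \<sigma> c))"
      by simp
  next
    fix \<sigma> assume \<sigma>A: "\<sigma> \<in> ?B"
    then have ext: "\<sigma> \<in> extensional C" and sub: "\<And>c. c \<in> C \<Longrightarrow> \<sigma> c \<subseteq> Vc c"
      and subW: "\<And>c. c \<in> C \<Longrightarrow> \<sigma> c \<subseteq> W"
      and ex: "\<And>v. v \<in> W \<Longrightarrow> \<exists>!c. c \<in> C \<and> v \<in> \<sigma> c"
      by (auto simp: cell_assignments_def PiE_iff)
    show "?i (?i \<sigma>) = \<sigma>"
      using ext sub by (intro extensionalityI[where A = C]) auto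
    have "\<exists>!c. c \<in> C \<and> v \<in> Vc c - \<sigma> c" if "v \<in> verts G" for v
    proof (cases "v \<in> W")
      case True
      then show ?thesis
        using twice[OF ex _ sub, of v] by blast
    next
      case False
      then show ?thesis
        using once[of v] that subW by blast
    qed
    then show "?i \<sigma> \<in> ?A"
      by (auto simp: cell_assignments_def PiE_iff cong: conj_cong)
  qed
  also have "\<dots> = matching_sum ?H"
  proof -
    have "matching_sum ?H =
        (\<Sum>\<sigma> \<in> ?B. \<Prod>c\<in>C. cell_sum ?f w {e \<in> E c. ?f e \<subseteq> W} (\<sigma> c))"
      using matching_sum_cells[of C "\<lambda>c. {e \<in> E c. ?f e \<subseteq> W}" ?H "\<lambda>c. Vc c \<inter> W"]
        C E disj edges ends Vc by (fastforce simp: interior_graph_def)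
    also have "\<dots> = (\<Sum>\<sigma> \<in> ?B. \<Prod>c\<in>C. cell_sum ?f w (E c) (\<sigma> c))"
      by (intro sum.cong prod.cong refl cell_sum_restrict)
        (auto simp: cell_assignments_def PiE_iff)
    finally show ?thesis ..
  qed
  finally show ?thesis .
qed

section \<open>Local matching sums of a four-cycle and their duality\<close>

lemma cell_sum_four_cycle:
  fixes f :: "'e \<Rightarrow> 'v set" and w :: "'e \<Rightarrow> 'w :: comm_semiring_1"
  assumes V: "distinct [u1, u2, v1, v2]" and E: "distinct [x, y, z, t]"
    and f: "f x = {u1, v1}" "f y = {u1, v2}" "f z = {u2, v1}" "f t = {u2, v2}"
    and S: "S \<subseteq> {u1, u2, v1, v2}"
  shows "cell_sum f w {x, y, z, t} S =
    (if u1 \<notin> S \<and> u2 \<notin> S \<and> v1 \<notin> S \<and> v2 \<notin> S then 1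
     else if u1 \<in> S \<and> u2 \<notin> S \<and> v1 \<in> S \<and> v2 \<notin> S then w x
     else if u1 \<in> S \<and> u2 \<notin> S \<and> v1 \<notin> S \<and> v2 \<in> S then w y
     else if u1 \<notin> S \<and> u2 \<in> S \<and> v1 \<in> S \<and> v2 \<notin> S then w z
     else if u1 \<notin> S \<and> u2 \<in> S \<and> v1 \<notin> S \<and> v2 \<in> S then w t
     else if u1 \<in> S \<and> u2 \<in> S \<and> v1 \<in> S \<and> v2 \<in> S then w x * w t + w y * w z
     else 0)"
proof -
  \<comment> \<open>These are all the matchings of the four-cycle: the empty one, the four single
    edges and the two pairs of opposite edges.\<close>
  let ?M = "{{}, {x}, {y}, {z}, {t}, {x, t}, {y, z}}"
  define g where "g Y = (if exact_cover f Y S then prod w Y else 0)" for Y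
  have single: "exact_cover f {e} S \<longleftrightarrow> S = f e" for e
    by (auto simp: exact_cover_def)
  have double: "exact_cover f {x, t} S \<longleftrightarrow> S = {u1, u2, v1, v2}"
    "exact_cover f {y, z} S \<longleftrightarrow> S = {u1, u2, v1, v2}"
    using V E by (auto simp: exact_cover_def f)
  have "cell_sum f w {x, y, z, t} S =
      (\<Sum>Y\<in>Pow {x, y, z, t}. g Y)"
    unfolding cell_sum_def g_def by (rule sum.inter_filter) simp
  also have "\<dots> = (\<Sum>Y\<in>?M. g Y)"
  proof (rule sum.mono_neutral_right)
    show "\<forall>Y\<in>Pow {x, y, z, t} - ?M. g Y = 0"
    proof
      fix Y assume Y: "Y \<in> Pow {x, y, z, t} - ?M"
      have "\<not> exact_cover f Y S"
      proof
        assume cov: "exact_cover f Y S"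
        have un: "e = e'" if "e \<in> Y" "e' \<in> Y" "v \<in> f e" "v \<in> f e'" for e e' v
          using cov that unfolding exact_cover_def by blast
        \<comment> \<open>Encoding \<open>Y\<close> by four truth values turns the claim into a
          finite propositional check: no two adjacent edges may both be present.\<close>
        obtain p q r s where pqrs: "p = (x \<in> Y)" "q = (y \<in> Y)" "r = (z \<in> Y)" "s = (t \<in> Y)"
          by blast
        have "\<not> (p \<and> q)" "\<not> (p \<and> r)" "\<not> (q \<and> s)" "\<not> (r \<and> s)"
          using un[of x y u1] un[of x z v1] un[of y t v2] un[of z t u2] E by (auto simp: f pqrs)
        moreover have "Y = {e. e = x \<and> p \<or> e = y \<and> q \<or> e = z \<and> r \<or> e = t \<and> s}"
          unfolding pqrs using Y by blast
        moreover have "{e. e = u \<or> e = v} = {u, v}" for u v :: 'e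
          by blast
        ultimately have "Y \<in> ?M"
          by (cases p; cases q; cases r; cases s) simp_all
        then show False
          using Y by blast
      qed
      then show "g Y = 0"
        by (simp add: g_def)
    qed
  qed auto
  also have "\<dots> = g {} + g {x} + g {y} + g {z} + g {t} + g {x, t} + g {y, z}"
  proof -
    have "{x, t} \<noteq> {y, z}"
      using E by (simp add: doubleton_eq_iff)
    then show ?thesis
      using E by (auto simp: add.assoc doubleton_eq_iff)
  qed
  finally have "cell_sum f w {x, y, z, t} S =
      g {} + g {x} + g {y} + g {z} + g {t} + g {x, t} + g {y, z}" .
  moreover have "exact_cover f {} S \<longleftrightarrow> u1 \<notin> S \<and> u2 \<notin> S \<and> v1 \<notin> S \<and> v2 \<notin> S"
    using S by (auto simp: exact_cover_def)
  moreover have "exact_cover f {x} S \<longleftrightarrow> u1 \<in> S \<and> u2 \<notin> S \<and> v1 \<in> S \<and> v2 \<notin> S"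
    "exact_cover f {y} S \<longleftrightarrow> u1 \<in> S \<and> u2 \<notin> S \<and> v1 \<notin> S \<and> v2 \<in> S"
    "exact_cover f {z} S \<longleftrightarrow> u1 \<notin> S \<and> u2 \<in> S \<and> v1 \<in> S \<and> v2 \<notin> S"
    "exact_cover f {t} S \<longleftrightarrow> u1 \<notin> S \<and> u2 \<in> S \<and> v1 \<notin> S \<and> v2 \<in> S"
    unfolding single f using S V by auto
  moreover have "exact_cover f {x, t} S \<longleftrightarrow> u1 \<in> S \<and> u2 \<in> S \<and> v1 \<in> S \<and> v2 \<in> S"
    "exact_cover f {y, z} S \<longleftrightarrow> u1 \<in> S \<and> u2 \<in> S \<and> v1 \<in> S \<and> v2 \<in> S"
    unfolding double using S by auto
  ultimately show ?thesis
    using E by (simp add: g_def)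
qed

text \<open>The complement of the ends of one edge is the pair of ends of the opposite edge, which
  accounts for the swapped weights. The empty and the full set are exchanged, matching
  \<open>1\<close> against \<open>\<Delta> * (1 / \<Delta>)\<close>. Every other \<open>S\<close> is
  not perfectly matchable, and neither is its complement, so both sides vanish.\<close>

lemma cell_sum_complement:
  fixes w w' :: "'e \<Rightarrow> 'w :: field"
  assumes V: "distinct [u1, u2, v1, v2]" and E: "distinct [x, y, z, t]"
    and f: "f x = {u1, v1}" "f y = {u1, v2}" "f z = {u2, v1}" "f t = {u2, v2}"
    and S: "S \<subseteq> {u1, u2, v1, v2}"
    and \<Delta>: "\<Delta> = w x * w t + w y * w z" "\<Delta> \<noteq> 0"
    and w': "w' x = w t / \<Delta>" "w' t = w x / \<Delta>" "w' y = w z / \<Delta>" "w' z = w y / \<Delta>"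
  shows "cell_sum f w {x, y, z, t} S = \<Delta> * cell_sum f w' {x, y, z, t} ({u1, u2, v1, v2} - S)"
proof -
  have *: "w' x * w' t + w' y * w' z = 1 / \<Delta>"
  proof -
    have "w' x * w' t + w' y * w' z = (w x * w t + w y * w z) / \<Delta>\<^sup>2"
      by (simp add: w' power2_eq_square add_divide_distrib mult.commute)
    then show ?thesis
      using \<Delta> by (simp add: power2_eq_square)
  qed
  show ?thesis
    using V \<Delta>(2)
    by (simp add: cell_sum_four_cycle[OF V E f S] cell_sum_four_cycle[OF V E f Diff_subset] *)
      (auto simp: w' \<Delta>(1))
qed

text \<open>Needed to recognise the interior of an Aztec diamond as a smaller diamond after renaming
  vertices and edges.\<close>

lemma matching_sum_iso:
  assumes f: "inj_on f (verts G)" "verts H = f ` verts G"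
    and g: "inj_on g (edges G)" "edges H = g ` edges G"
    and ends: "\<And>e. e \<in> edges G \<Longrightarrow> ends G e \<subseteq> verts G"
      "\<And>e. e \<in> edges G \<Longrightarrow> ends H (g e) = f ` ends G e"
    and wt: "\<And>e. e \<in> edges G \<Longrightarrow> wt H (g e) = wt G e"
  shows "matching_sum H = matching_sum G"
proof -
  have pm: "g ` X \<in> perfect_matchings H \<longleftrightarrow> X \<in> perfect_matchings G" if X: "X \<subseteq> edges G" for X
  proof -
    have mem: "f v \<in> ends H (g e) \<longleftrightarrow> v \<in> ends G e" if "e \<in> X" "v \<in> verts G" for e v
      using that ends X f(1) by (auto simp: inj_on_def) blast
    have "(\<exists>!e. e \<in> g ` X \<and> f v \<in> ends H e) \<longleftrightarrow> (\<exists>!e. e \<in> X \<and> v \<in> ends G e)"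
      if v: "v \<in> verts G" for v
    proof -
      have "(\<exists>!e. e \<in> g ` X \<and> f v \<in> ends H e) \<longleftrightarrow> (\<exists>!e. e \<in> g ` {e \<in> X. v \<in> ends G e})"
        using mem v by (intro arg_cong[of _ _ Ex1] ext) auto
      also have "\<dots> \<longleftrightarrow> (\<exists>!e. e \<in> {e \<in> X. v \<in> ends G e})"
        using inj_on_subset[OF g(1) X] by (auto simp: inj_on_def Ex1_def)
      finally show ?thesis
        by simp
    qed
    then show ?thesis
      using X f g by (auto simp: perfect_matchings_def)
  qed
  have sub: "X \<subseteq> edges G" if "X \<in> perfect_matchings G" for X
    using that by (simp add: perfect_matchings_def)
  have "perfect_matchings H = (`) g ` perfect_matchings G"
  proof
    show "perfect_matchings H \<subseteq> (`) g ` perfect_matchings G"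
    proof
      fix Y assume Y: "Y \<in> perfect_matchings H"
      then have "Y \<subseteq> g ` edges G"
        by (simp add: perfect_matchings_def g)
      then obtain X where X: "X \<subseteq> edges G" "Y = g ` X"
        by (auto simp: subset_image_iff)
      then show "Y \<in> (`) g ` perfect_matchings G"
        using pm Y by blast
    qed
  qed (use pm sub in blast)
  moreover have "inj_on ((`) g) (perfect_matchings G)"
    using inj_on_subset[OF inj_on_image_Pow[OF g(1)]] sub by blast
  ultimately have "matching_sum H = (\<Sum>X\<in>perfect_matchings G. \<Prod>e\<in>g ` X. wt H e)"
    by (simp add: matching_sum_def sum.reindex)
  also have "\<dots> = (\<Sum>X\<in>perfect_matchings G. \<Prod>e\<in>X. wt G e)"
  proof (rule sum.cong)
    fix X assume "X \<in> perfect_matchings G"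
    then have X: "X \<subseteq> edges G"
      by (rule sub)
    show "(\<Prod>e\<in>g ` X. wt H e) = (\<Prod>e\<in>X. wt G e)"
      using X wt by (subst prod.reindex[OF inj_on_subset[OF g(1) X]]) (auto intro!: prod.cong)
  qed simp
  finally show ?thesis
    by (simp add: matching_sum_def)
qed

section \<open>Reduction of the Aztec diamond\<close>

text \<open>Weights are a function of the edge position rather than a periodic matrix, since the
  reduction produces them in this form.\<close>

definition aztec :: "nat \<Rightarrow> (nat \<times> nat \<Rightarrow> 'w) \<Rightarrow> (aztec_vertex, nat \<times> nat, 'w) weighted_graph" where
  "aztec n w = \<lparr>verts = aztec_verts n, edges = aztec_edges n, ends = aztec_ends, wt = w\<rparr>"

fun cell_edges :: "nat \<times> nat \<Rightarrow> (nat \<times> nat) set" where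
  "cell_edges (p, q) = {(2 * p - 1, 2 * q - 1), (2 * p - 1, 2 * q), (2 * p, 2 * q - 1), (2 * p, 2 * q)}"

fun cell_verts :: "nat \<times> nat \<Rightarrow> aztec_vertex set" where
  "cell_verts (p, q) = {U p q, U (p + 1) q, V p q, V p (q + 1)}"

text \<open>The matching sum of a single cell, called \<open>\<Delta>\<close> in the local
  identity.\<close>

fun cell_factor :: "(nat \<times> nat \<Rightarrow> 'w :: comm_semiring_1) \<Rightarrow> nat \<times> nat \<Rightarrow> 'w" where
  "cell_factor w (p, q) =
     w (2 * p - 1, 2 * q - 1) * w (2 * p, 2 * q) + w (2 * p - 1, 2 * q) * w (2 * p, 2 * q - 1)"

text \<open>\<open>mirror\<close> swaps \<open>2 * p - 1\<close> and \<open>2 * p\<close>; applied to both coordinates it gives the opposite edge of a cell.\<close>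

definition mirror :: "nat \<Rightarrow> nat" where
  "mirror r = (if odd r then r + 1 else r - 1)"

fun dual_weight :: "(nat \<times> nat \<Rightarrow> 'w :: field) \<Rightarrow> nat \<times> nat \<Rightarrow> 'w" where
  "dual_weight w (r, s) = w (mirror r, mirror s) / cell_factor w ((r + 1) div 2, (s + 1) div 2)"

text \<open>The shift by one reflects that the outermost ring of edges is lost.\<close>

definition reduced_weight :: "(nat \<times> nat \<Rightarrow> 'w :: field) \<Rightarrow> nat \<times> nat \<Rightarrow> 'w" where
  "reduced_weight w = (\<lambda>(r, s). dual_weight w (r + 1, s + 1))"

lemma matching_sum_aztec_cong:
  assumes "\<And>r s. r \<in> {1..2 * n} \<Longrightarrow> s \<in> {1..2 * n} \<Longrightarrow> w (r, s) = w' (r, s)"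
  shows "matching_sum (aztec n w) = matching_sum (aztec n w')"
proof -
  have "perfect_matchings (aztec n w) = perfect_matchings (aztec n w')"
    by (simp add: perfect_matchings_def aztec_def)
  moreover have "(\<Prod>e\<in>X. w e) = (\<Prod>e\<in>X. w' e)" if "X \<in> perfect_matchings (aztec n w')" for X
    using that assms by (intro prod.cong) (auto simp: perfect_matchings_def aztec_def aztec_edges_def)
  ultimately show ?thesis
    by (simp add: matching_sum_def aztec_def)
qed

lemma matching_sum_aztec_0: "matching_sum (aztec 0 w) = 1"
proof -
  have "perfect_matchings (aztec 0 w) = {{}}"
    by (auto simp: perfect_matchings_def aztec_def aztec_edges_def aztec_verts_def)
  then show ?thesis
    by (simp add: matching_sum_def)
qed

text \<open>Deleting the boundary exchanges the two colour classes: the remaining \<open>V\<close>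
  vertices play the role of the \<open>U\<close> vertices of the smaller diamond and vice versa,
  while edges move by one position along the diagonal.\<close>

lemma matching_sum_aztec_interior:
  "matching_sum (aztec n (reduced_weight w)) =
   matching_sum (interior_graph (aztec (Suc n) w)
     {v. \<exists>i j. i \<in> {1..n} \<and> j \<in> {1..n + 1} \<and> (v = U (i + 1) j \<or> v = V j (i + 1))} (dual_weight w))"
    (is "_ = matching_sum (interior_graph _ ?W _)")
proof (rule sym, rule matching_sum_iso)
  let ?f = "case_aztec_vertex (\<lambda>i j. V i (j + 1)) (\<lambda>i j. U (i + 1) j)"
  let ?g = "\<lambda>e :: nat \<times> nat. (fst e + 1, snd e + 1)"
  show "inj_on ?f (verts (aztec n (reduced_weight w)))"
    by (auto simp: inj_on_def split: aztec_vertex.splits)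
  show "verts (interior_graph (aztec (Suc n) w) ?W (dual_weight w)) =
      ?f ` verts (aztec n (reduced_weight w))"
  proof -
    have "verts (aztec n (reduced_weight w)) =
        (\<lambda>(i, j). U i j) ` ({1..n + 1} \<times> {1..n}) \<union> (\<lambda>(i, j). V i j) ` ({1..n} \<times> {1..n + 1})"
      by (auto simp: aztec_def aztec_verts_def)
    then have "?f ` verts (aztec n (reduced_weight w)) =
        (\<lambda>(i, j). V i (j + 1)) ` ({1..n + 1} \<times> {1..n}) \<union>
        (\<lambda>(i, j). U (i + 1) j) ` ({1..n} \<times> {1..n + 1})"
      by (simp add: image_Un image_image case_prod_unfold)
    also have "\<dots> = ?W"
      by (auto simp: image_iff)
    finally show ?thesis
      by (simp add: interior_graph_def)
  qed
  show "inj_on ?g (edges (aztec n (reduced_weight w)))"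
    by (auto simp: inj_on_def)
  show "edges (interior_graph (aztec (Suc n) w) ?W (dual_weight w)) =
      ?g ` edges (aztec n (reduced_weight w))"
  proof
    show "edges (interior_graph (aztec (Suc n) w) ?W (dual_weight w)) \<subseteq>
      ?g ` edges (aztec n (reduced_weight w))"
    proof
      fix e assume e: "e \<in> edges (interior_graph (aztec (Suc n) w) ?W (dual_weight w))"
      obtain r s where rs: "e = (r, s)" by (cases e)
      \<comment> \<open>Having both ends in the interior excludes exactly the first and last row and
        column of the edge array.\<close>
      have *: "1 \<le> r" "1 \<le> s" "1 \<le> r div 2" "r div 2 \<le> n" "1 \<le> s div 2" "s div 2 \<le> n"
        using e by (auto simp: rs interior_graph_def aztec_def aztec_edges_def)
      have "e = ?g (r - 1, s - 1)"
        using * by (simp add: rs)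
      moreover have "(r - 1, s - 1) \<in> edges (aztec n (reduced_weight w))"
        using * by (auto simp: aztec_def aztec_edges_def)
      ultimately show "e \<in> ?g ` edges (aztec n (reduced_weight w))"
        by blast
    qed
    show "?g ` edges (aztec n (reduced_weight w)) \<subseteq>
        edges (interior_graph (aztec (Suc n) w) ?W (dual_weight w))"
      by (auto simp: interior_graph_def aztec_def aztec_edges_def) linarith+
  qed
  fix e assume e: "e \<in> edges (aztec n (reduced_weight w))"
  then show "ends (aztec n (reduced_weight w)) e \<subseteq> verts (aztec n (reduced_weight w))"
    using aztec_ends_in_verts by (simp add: aztec_def)
  show "ends (interior_graph (aztec (Suc n) w) ?W (dual_weight w)) (?g e) =
      ?f ` ends (aztec n (reduced_weight w)) e"
    by (cases e) (auto simp: interior_graph_def aztec_def)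
  show "wt (interior_graph (aztec (Suc n) w) ?W (dual_weight w)) (?g e) =
      wt (aztec n (reduced_weight w)) e"
    by (simp add: interior_graph_def aztec_def reduced_weight_def case_prod_unfold)
qed

text \<open>Each edge position computes its own cell, from which disjointness of the cells and
  coverage of all edges are immediate.\<close>

lemma cell_edges_iff:
  assumes "p \<ge> 1" "q \<ge> 1"
  shows "(r, s) \<in> cell_edges (p, q) \<longleftrightarrow> r \<ge> 1 \<and> s \<ge> 1 \<and> (r + 1) div 2 = p \<and> (s + 1) div 2 = q"
  using assms by auto

text \<open>Urban renewal in every cell at once: an inner \<open>U\<close> vertex lies in two
  vertically adjacent cells, an inner \<open>V\<close> vertex in two horizontally adjacent ones, and
  boundary vertices in one cell each.\<close>

lemma aztec_reduction:
  fixes w :: "nat \<times> nat \<Rightarrow> 'w :: field"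
  assumes nz: "\<And>p q. p \<in> {1..Suc n} \<Longrightarrow> q \<in> {1..Suc n} \<Longrightarrow> cell_factor w (p, q) \<noteq> 0"
  shows "matching_sum (aztec (Suc n) w) =
    (\<Prod>c\<in>{1..Suc n} \<times> {1..Suc n}. cell_factor w c) * matching_sum (aztec n (reduced_weight w))"
  unfolding matching_sum_aztec_interior
proof (rule matching_sum_complement[where E = cell_edges and Vc = cell_verts])
  let ?C = "{1..Suc n} \<times> {1..Suc n}"
  let ?G = "aztec (Suc n) w"
  let ?W = "{v. \<exists>i j. i \<in> {1..n} \<and> j \<in> {1..n + 1} \<and> (v = U (i + 1) j \<or> v = V j (i + 1))}"
  show "finite ?C"
    by simp
  show "finite (cell_edges c)" "finite (cell_verts c)" for c
    by (cases c; simp)+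
  show "cell_edges c \<inter> cell_edges c' = {}" if "c \<in> ?C" "c' \<in> ?C" "c \<noteq> c'" for c c'
    using that by (cases c; cases c') (auto simp del: cell_edges.simps simp: cell_edges_iff)
  show "edges ?G = (\<Union>c\<in>?C. cell_edges c)"
  proof (rule Set.set_eqI)
    fix e :: "nat \<times> nat"
    obtain r s where rs: "e = (r, s)" by (cases e)
    have "e \<in> (\<Union>c\<in>?C. cell_edges c) \<longleftrightarrow>
        (\<exists>p\<in>{1..Suc n}. \<exists>q\<in>{1..Suc n}. (r, s) \<in> cell_edges (p, q))"
      by (auto simp: rs simp del: cell_edges.simps)
    also have "\<dots> \<longleftrightarrow> r \<ge> 1 \<and> s \<ge> 1 \<and> (r + 1) div 2 \<in> {1..Suc n} \<and> (s + 1) div 2 \<in> {1..Suc n}"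
      by (auto simp: cell_edges_iff simp del: cell_edges.simps)
    also have "\<dots> \<longleftrightarrow> e \<in> edges ?G"
      by (auto simp: rs aztec_def aztec_edges_def)
    finally show "e \<in> edges ?G \<longleftrightarrow> e \<in> (\<Union>c\<in>?C. cell_edges c)" ..
  qed
  show "ends ?G e \<subseteq> cell_verts c" if "c \<in> ?C" "e \<in> cell_edges c" for c e
    using that by (cases c; cases e) (auto simp: aztec_def)
  show "cell_verts c \<subseteq> verts ?G" if "c \<in> ?C" for c
    using that by (cases c) (auto simp: aztec_def aztec_verts_def)
  show "?W \<subseteq> verts ?G"
    by (auto simp: aztec_def aztec_verts_def)
  show "card {c \<in> ?C. v \<in> cell_verts c} = 2" if v: "v \<in> ?W" for v
  proof -
    obtain i j where ij: "i \<in> {1..n}" "j \<in> {1..n + 1}" "v = U (i + 1) j \<or> v = V j (i + 1)"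
      using v by blast
    then have "{c \<in> ?C. v \<in> cell_verts c} =
        (if v = U (i + 1) j then {(i, j), (i + 1, j)} else {(j, i), (j, i + 1)})"
      by auto
    then show ?thesis
      by simp
  qed
  show "card {c \<in> ?C. v \<in> cell_verts c} = 1" if v: "v \<in> verts ?G - ?W" for v
  proof (cases v)
    case (U i j)
    have ij: "i \<in> {1..n + 2}" "j \<in> {1..Suc n}"
      using v by (simp_all add: U aztec_def aztec_verts_def)
    moreover have "i - 1 \<notin> {1..n}"
    proof
      assume "i - 1 \<in> {1..n}"
      then have "v \<in> ?W"
        using ij by (auto simp: U intro!: exI[of _ "i - 1"])
      then show False
        using v by blast
    qed
    ultimately have "i = 1 \<or> i = n + 2" "j \<in> {1..Suc n}"
      by auto
    then have "{c \<in> ?C. v \<in> cell_verts c} = {(if i = 1 then 1 else n + 1, j)}"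
      by (auto simp: U)
    then show ?thesis
      by simp
  next
    case (V i j)
    have ij: "j \<in> {1..n + 2}" "i \<in> {1..Suc n}"
      using v by (simp_all add: V aztec_def aztec_verts_def)
    moreover have "j - 1 \<notin> {1..n}"
    proof
      assume "j - 1 \<in> {1..n}"
      then have "v \<in> ?W"
        using ij by (auto simp: V intro!: exI[of _ "j - 1"])
      then show False
        using v by blast
    qed
    ultimately have "j = 1 \<or> j = n + 2" "i \<in> {1..Suc n}"
      by auto
    then have "{c \<in> ?C. v \<in> cell_verts c} = {(i, if j = 1 then 1 else n + 1)}"
      by (auto simp: V)
    then show ?thesis
      by simp
  qed
  show "cell_sum (ends ?G) (wt ?G) (cell_edges c) S =
      cell_factor w c * cell_sum (ends ?G) (dual_weight w) (cell_edges c) (cell_verts c - S)"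
    if c: "c \<in> ?C" and S: "S \<subseteq> cell_verts c" for c S
  proof -
    obtain p q where pq: "c = (Suc p, Suc q)" "p \<le> n" "q \<le> n"
      using c by (cases c) (auto simp: Suc_le_eq gr0_conv_Suc)
    show ?thesis
      using nz[of "Suc p" "Suc q"] S pq(2,3) unfolding pq(1) cell_edges.simps cell_verts.simps
      by (intro cell_sum_complement)
        (auto simp: aztec_def mirror_def)
  qed
qed

section \<open>The product formula\<close>

text \<open>
  This is the claimed value for \<open>m = \<lceil>n/2\<rceil>\<close> and \<open>l = \<lfloor>n/2\<rfloor>\<close>, with all products extended to
  \<open>1..n\<close>: the exponents that the extension adds are truncated to zero.
\<close>

definition closed_form ::
    "nat \<Rightarrow> nat \<Rightarrow> (nat \<Rightarrow> 'w :: field) \<Rightarrow> (nat \<Rightarrow> 'w) \<Rightarrow> (nat \<Rightarrow> 'w) \<Rightarrow> (nat \<Rightarrow> 'w) \<Rightarrow> 'w" where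
  "closed_form m l a b c d =
     2 ^ (m * (l + 1))
     * (\<Prod>q = 1..m + l. a q ^ (m + 1 - q) * b q ^ (q - l) * c q ^ (l + 1 - q) * d q ^ (q - m))
     * (\<Prod>q = 1..<m + l. (d q * a (q + 1) + b q * c (q + 1)) ^ min q (m + l - q))"

section \<open>Index ranges of products and totals of exponents\<close>

lemma prod_power_extend:
  fixes f :: "nat \<Rightarrow> 'w :: comm_semiring_1"
  assumes "n \<le> n'" "\<And>q. n < q \<Longrightarrow> q \<le> n' \<Longrightarrow> e q = 0"
  shows "(\<Prod>q = 1..n. f q ^ e q) = (\<Prod>q = 1..n'. f q ^ e q)"
  using assms by (intro prod.mono_neutral_left) auto

lemma prod_power_shift:
  fixes f :: "nat \<Rightarrow> 'w :: comm_semiring_1"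
  assumes "e 1 = 0"
  shows "(\<Prod>q = 1..n. f (q + 1) ^ e (q + 1)) = (\<Prod>q = 1..n + 1. f q ^ e q)"
proof -
  have "(\<Prod>q = 1..n + 1. f q ^ e q) = f 1 ^ e 1 * (\<Prod>q = Suc 1..Suc n. f q ^ e q)"
    using prod.atLeast_Suc_atMost[of 1 "n + 1" "\<lambda>q. f q ^ e q"] by simp
  also have "(\<Prod>q = Suc 1..Suc n. f q ^ e q) = (\<Prod>q = 1..n. f (q + 1) ^ e (q + 1))"
    unfolding prod.shift_bounds_cl_Suc_ivl by simp
  finally show ?thesis
    using assms by simp
qed

lemma sum_descending: "2 * (\<Sum>q = 1..x + y. x + 1 - q) = x * (x + 1 :: nat)"
proof -
  have "(\<Sum>q = 1..x + y. x + 1 - q) = (\<Sum>q = 1..x. x + 1 - q)"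
    by (rule sum.mono_neutral_right) auto
  also have "\<dots> = (\<Sum>q = 1..x. q)"
    by (subst sum.atLeastAtMost_rev) (auto intro!: sum.cong)
  also have "2 * \<dots> = x * (x + 1)"
    by (induction x) auto
  finally show ?thesis .
qed

lemma sum_ascending: "2 * (\<Sum>q = 1..x + y. q - y) = x * (x + 1 :: nat)"
proof -
  have "(\<Sum>q = 1..x + y. q - y) = (\<Sum>q = 1..x + y. x + 1 - q)"
    by (subst sum.atLeastAtMost_rev) (auto intro!: sum.cong)
  then show ?thesis
    using sum_descending[of x y] by simp
qed

text \<open>The summands form a tent. Splitting off the first term and lowering the others by one
  leaves the tent for \<open>m - 1\<close> and \<open>l - 1\<close>, plus a zero term at the
  end.\<close>

lemma sum_min_reflect:
  assumes "l \<le> m" "m \<le> l + 1"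
  shows "(\<Sum>q = 1..<m + l. min q (m + l - q)) = m * (l :: nat)"
  using assms
proof (induction l arbitrary: m)
  case 0
  then have "m = 0 \<or> m = 1"
    by auto
  then show ?case
    by auto
next
  case (Suc l)
  then obtain k where m: "m = Suc k"
    by (cases m) auto
  have "(\<Sum>q = 1..<m + Suc l. min q (m + Suc l - q)) =
      (\<Sum>q = 1..<Suc (Suc (k + l)). min q (Suc (Suc (k + l)) - q))"
    by (simp add: m)
  also have "\<dots> = 1 + (\<Sum>q = Suc 1..<Suc (Suc (k + l)). min q (Suc (Suc (k + l)) - q))"
    by (subst sum.atLeast_Suc_lessThan) auto
  also have "\<dots> = 1 + (\<Sum>q = 1..<Suc (k + l). min (Suc q) (Suc (k + l) - q))"
    by (simp add: sum.shift_bounds_Suc_ivl del: sum.op_ivl_Suc)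
  also have "(\<Sum>q = 1..<Suc (k + l). min (Suc q) (Suc (k + l) - q)) =
      (\<Sum>q = 1..<Suc (k + l). 1 + min q (k + l - q))"
    by (intro sum.cong) auto
  also have "\<dots> = k + l + (\<Sum>q = 1..<Suc (k + l). min q (k + l - q))"
    by (simp only: sum.distrib) simp
  also have "(\<Sum>q = 1..<Suc (k + l). min q (k + l - q)) = (\<Sum>q = 1..<k + l. min q (k + l - q))"
    by (cases "k + l") auto
  also have "\<dots> = k * l"
    using Suc.prems m by (intro Suc.IH) auto
  finally show ?case
    by (simp add: m)
qed

lemma power_cancel_inverse:
  fixes x :: "'w :: field"
  assumes "x \<noteq> 0" "i = j + k"
  shows "x ^ i * inverse x ^ j = x ^ k"
  using assms by (simp add: power_add power_inverse)

text \<open>For the weights after two reductions, the factor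
  \<open>d q * a (q + 1) + b q * c (q + 1)\<close> of the product formula collapses to
  \<open>inverse (\<Delta> (q + 1))\<close>.\<close>

lemma inverse_cross_sum:
  fixes x y z t \<Delta> :: "'w :: field"
  assumes "\<Delta> = inverse (2 * y) * inverse (2 * z) + inverse (2 * x) * inverse (2 * t)" "\<Delta> \<noteq> 0"
  shows "inverse (2 * z * \<Delta>) * inverse (2 * y * \<Delta>) + inverse (2 * x * \<Delta>) * inverse (2 * t * \<Delta>) =
    inverse \<Delta>"
proof -
  have "inverse (2 * z * \<Delta>) * inverse (2 * y * \<Delta>) + inverse (2 * x * \<Delta>) * inverse (2 * t * \<Delta>) =
      (inverse (2 * y) * inverse (2 * z) + inverse (2 * x) * inverse (2 * t)) * (inverse \<Delta> * inverse \<Delta>)"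
    by (simp only: inverse_mult_distrib ring_distribs mult_ac)
  also have "\<dots> = \<Delta> * (inverse \<Delta> * inverse \<Delta>)"
    by (simp only: assms(1)[symmetric])
  finally show ?thesis
    using assms(2) by simp
qed

text \<open>The algebraic half of the induction: the cell factors of two reductions, times the
  formula for the new weights, give the formula for the old ones. Both sides are monomials in
  \<open>2\<close>, the four sequences and the sums \<open>D q\<close>, so exponents are compared
  one base at a time.\<close>

lemma closed_form_step:
  fixes a b c d :: "nat \<Rightarrow> 'w :: field_char_0"
  assumes ml: "l \<le> m" "m \<le> l + 1"
    and nz: "\<And>q. q \<in> {1..m + l + 2} \<Longrightarrow> a q \<noteq> 0" "\<And>q. q \<in> {1..m + l + 2} \<Longrightarrow> b q \<noteq> 0"
      "\<And>q. q \<in> {1..m + l + 2} \<Longrightarrow> c q \<noteq> 0" "\<And>q. q \<in> {1..m + l + 2} \<Longrightarrow> d q \<noteq> 0"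
      "\<And>q. q \<in> {1..m + l + 1} \<Longrightarrow> \<Delta> q \<noteq> 0"
    and \<Delta>: "\<And>q. q \<in> {1..m + l + 1} \<Longrightarrow>
      \<Delta> q = inverse (2 * b q) * inverse (2 * c (q + 1)) + inverse (2 * a (q + 1)) * inverse (2 * d q)"
  shows "(\<Prod>q = 1..m + l + 2. 2 * a q * b q) ^ (m + 1) * (\<Prod>q = 1..m + l + 2. 2 * c q * d q) ^ (l + 1)
      * (\<Prod>q = 1..m + l + 1. \<Delta> q) ^ (m + l + 1)
      * closed_form m l (\<lambda>q. inverse (2 * b q * \<Delta> q)) (\<lambda>q. inverse (2 * a (q + 2) * \<Delta> (q + 1)))
          (\<lambda>q. inverse (2 * d q * \<Delta> q)) (\<lambda>q. inverse (2 * c (q + 2) * \<Delta> (q + 1)))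
    = closed_form (m + 1) (l + 1) a b c d"
proof -
  define N where "N = m + l + 2"
  have N': "N = m + l + 1 + 1"
    by (simp add: N_def)
  define D where "D q = d q * a (q + 1) + b q * c (q + 1)" for q
  let ?i = "inverse :: 'w \<Rightarrow> 'w"
  have \<Delta>_D: "\<Delta> q = ?i 4 * ?i (a (q + 1)) * ?i (b q) * ?i (c (q + 1)) * ?i (d q) * D q"
    if "q \<in> {1..m + l + 1}" for q
    using \<Delta>[OF that] nz(1,3)[of "q + 1"] nz(2,4)[of q] that
    by (simp add: D_def field_simps)
  have desc: "(\<Prod>q = 1..m + l. ?i (2 * f q * \<Delta> q) ^ (x + 1 - q)) =
      ?i 2 ^ (\<Sum>q = 1..m + l. x + 1 - q) * (\<Prod>q = 1..N. ?i (f q) ^ (x + 1 - q))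
      * (\<Prod>q = 1..m + l + 1. ?i (\<Delta> q) ^ (x + 1 - q))"
    if "x \<le> m + l" for f :: "nat \<Rightarrow> 'w" and x
  proof -
    have "(\<Prod>q = 1..m + l. ?i (f q) ^ (x + 1 - q)) = (\<Prod>q = 1..N. ?i (f q) ^ (x + 1 - q))"
      "(\<Prod>q = 1..m + l. ?i (\<Delta> q) ^ (x + 1 - q)) =
        (\<Prod>q = 1..m + l + 1. ?i (\<Delta> q) ^ (x + 1 - q))"
      using that by (auto intro!: prod_power_extend simp: N_def)
    then show ?thesis
      by (simp only: inverse_mult_distrib power_mult_distrib prod.distrib power_sum)
  qed
  \<comment> \<open>Re-indexing by two for \<open>f\<close> and by one for \<open>\<Delta>\<close>
    adds only terms whose truncated exponent is zero.\<close>
  have asc: "(\<Prod>q = 1..m + l. ?i (2 * f (q + 2) * \<Delta> (q + 1)) ^ (q - y)) =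
      ?i 2 ^ (\<Sum>q = 1..m + l. q - y) * (\<Prod>q = 1..N. ?i (f q) ^ (q - 2 - y))
      * (\<Prod>q = 1..m + l + 1. ?i (\<Delta> q) ^ (q - 1 - y))" for f :: "nat \<Rightarrow> 'w" and y
  proof -
    have "(\<Prod>q = 1..N. ?i (f q) ^ (q - 2 - y)) =
        (\<Prod>q = 1..m + l + 1. ?i (f (q + 1)) ^ (q + 1 - 2 - y))"
      unfolding N' by (rule sym, rule prod_power_shift) simp
    also have "\<dots> = (\<Prod>q = 1..m + l. ?i (f (q + 1 + 1)) ^ (q + 1 + 1 - 2 - y))"
      by (rule sym, rule prod_power_shift[where e = "\<lambda>q. q + 1 - 2 - y" and f = "\<lambda>q. ?i (f (q + 1))"]) simp
    also have "\<dots> = (\<Prod>q = 1..m + l. ?i (f (q + 2)) ^ (q - y))"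
      by simp
    finally have "(\<Prod>q = 1..m + l. ?i (f (q + 2)) ^ (q - y)) =
        (\<Prod>q = 1..N. ?i (f q) ^ (q - 2 - y))" ..
    moreover have "(\<Prod>q = 1..m + l. ?i (\<Delta> (q + 1)) ^ (q - y)) =
        (\<Prod>q = 1..m + l + 1. ?i (\<Delta> q) ^ (q - 1 - y))"
      using prod_power_shift[of "\<lambda>q. q - 1 - y" "\<lambda>q. ?i (\<Delta> q)" "m + l"] by simp
    ultimately show ?thesis
      by (simp only: inverse_mult_distrib power_mult_distrib prod.distrib power_sum)
  qed
  have mid: "(\<Prod>q = 1..<m + l. (?i (2 * c (q + 2) * \<Delta> (q + 1)) * ?i (2 * b (q + 1) * \<Delta> (q + 1))
        + ?i (2 * a (q + 2) * \<Delta> (q + 1)) * ?i (2 * d (q + 1) * \<Delta> (q + 1))) ^ min q (m + l - q)) =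
      (\<Prod>q = 1..m + l + 1. ?i (\<Delta> q) ^ min (q - 1) (m + l + 1 - q))"
  proof -
    have "?i (2 * c (q + 2) * \<Delta> (q + 1)) * ?i (2 * b (q + 1) * \<Delta> (q + 1))
        + ?i (2 * a (q + 2) * \<Delta> (q + 1)) * ?i (2 * d (q + 1) * \<Delta> (q + 1)) = ?i (\<Delta> (q + 1))"
      if "q \<in> {1..<m + l}" for q
      using \<Delta>[of "q + 1"] nz(5)[of "q + 1"] that by (intro inverse_cross_sum) simp_all
    then have "(\<Prod>q = 1..<m + l. (?i (2 * c (q + 2) * \<Delta> (q + 1)) * ?i (2 * b (q + 1) * \<Delta> (q + 1))
        + ?i (2 * a (q + 2) * \<Delta> (q + 1)) * ?i (2 * d (q + 1) * \<Delta> (q + 1))) ^ min q (m + l - q)) =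
        (\<Prod>q = 1..<m + l. ?i (\<Delta> (q + 1)) ^ min q (m + l - q))"
      by (intro prod.cong) auto
    also have "\<dots> = (\<Prod>q = 1..m + l. ?i (\<Delta> (q + 1)) ^ min q (m + l - q))"
      by (intro prod.mono_neutral_left) auto
    also have "\<dots> = (\<Prod>q = 1..m + l + 1. ?i (\<Delta> q) ^ min (q - 1) (m + l + 1 - q))"
      using prod_power_shift[of "\<lambda>q. min (q - 1) (m + l + 1 - q)" "\<lambda>q. ?i (\<Delta> q)" "m + l"] by simp
    finally show ?thesis .
  qed
  define S where "S = (\<Sum>q = 1..m + l. m + 1 - q) + (\<Sum>q = 1..m + l. q - l)
      + (\<Sum>q = 1..m + l. l + 1 - q) + (\<Sum>q = 1..m + l. q - m)"
  define M where "M = (\<Sum>q = 1..m + l + 1. min q (N - q))"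
  \<comment> \<open>The net exponent of \<open>\<Delta> q\<close> is \<open>min q (N - q)\<close>,
    precisely the exponent of \<open>D q\<close> in the target.\<close>
  have \<Delta>_prod: "(\<Prod>q = 1..m + l + 1. \<Delta> q) ^ (m + l + 1)
      * ((\<Prod>q = 1..m + l + 1. ?i (\<Delta> q) ^ (m + 1 - q)) * (\<Prod>q = 1..m + l + 1. ?i (\<Delta> q) ^ (q - 1 - l))
        * (\<Prod>q = 1..m + l + 1. ?i (\<Delta> q) ^ (l + 1 - q)) * (\<Prod>q = 1..m + l + 1. ?i (\<Delta> q) ^ (q - 1 - m))
        * (\<Prod>q = 1..m + l + 1. ?i (\<Delta> q) ^ min (q - 1) (m + l + 1 - q))) =
      (\<Prod>q = 1..m + l + 1. \<Delta> q ^ min q (N - q))"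
    unfolding prod_power_distrib prod.distrib[symmetric] power_add[symmetric]
  proof (rule prod.cong)
    fix q assume "q \<in> {1..m + l + 1}"
    then show "\<Delta> q ^ (m + l + 1) * ?i (\<Delta> q) ^ (m + 1 - q + (q - 1 - l) + (l + 1 - q) + (q - 1 - m)
        + min (q - 1) (m + l + 1 - q)) = \<Delta> q ^ min q (N - q)"
      using nz(5) ml by (intro power_cancel_inverse) (auto simp: N_def)
  qed simp
  have \<Delta>_split: "(\<Prod>q = 1..m + l + 1. \<Delta> q ^ min q (N - q)) =
      ?i 4 ^ M * (\<Prod>q = 1..N. ?i (a q) ^ min (q - 1) (N + 1 - q)) * (\<Prod>q = 1..N. ?i (b q) ^ min q (N - q))
      * (\<Prod>q = 1..N. ?i (c q) ^ min (q - 1) (N + 1 - q)) * (\<Prod>q = 1..N. ?i (d q) ^ min q (N - q))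
      * (\<Prod>q = 1..<N. D q ^ min q (N - q))"
  proof -
    \<comment> \<open>The sequences \<open>a\<close> and \<open>c\<close> enter
      \<open>\<Delta> q\<close> with index \<open>q + 1\<close>, so their exponents appear shifted
      compared with those of \<open>b\<close> and \<open>d\<close>.\<close>
    have up: "(\<Prod>q = 1..m + l + 1. ?i (f (q + 1)) ^ min q (N - q)) =
        (\<Prod>q = 1..N. ?i (f q) ^ min (q - 1) (N + 1 - q))" for f :: "nat \<Rightarrow> 'w"
      using prod_power_shift[of "\<lambda>q. min (q - 1) (N + 1 - q)" "\<lambda>q. ?i (f q)" "m + l + 1"]
      by (simp add: N_def)
    have same: "(\<Prod>q = 1..m + l + 1. ?i (f q) ^ min q (N - q)) =
        (\<Prod>q = 1..N. ?i (f q) ^ min q (N - q))" for f :: "nat \<Rightarrow> 'w"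
      by (rule prod_power_extend) (auto simp: N_def)
    have range: "{1..m + l + 1} = {1..<N}"
      by (auto simp: N_def)
    have "(\<Prod>q = 1..m + l + 1. \<Delta> q ^ min q (N - q)) =
        (\<Prod>q = 1..m + l + 1. (?i 4 * ?i (a (q + 1)) * ?i (b q) * ?i (c (q + 1)) * ?i (d q) * D q)
          ^ min q (N - q))"
      by (intro prod.cong refl) (simp only: \<Delta>_D)
    then show ?thesis
      unfolding power_mult_distrib prod.distrib up same power_sum[symmetric] M_def[symmetric]
      by (simp only: range)
  qed
  have a_prod: "(\<Prod>q = 1..N. a q) ^ (m + 1) * ((\<Prod>q = 1..N. ?i (a q) ^ (q - 2 - l))
      * (\<Prod>q = 1..N. ?i (a q) ^ min (q - 1) (N + 1 - q))) = (\<Prod>q = 1..N. a q ^ (m + 1 + 1 - q))"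
    and c_prod: "(\<Prod>q = 1..N. c q) ^ (l + 1) * ((\<Prod>q = 1..N. ?i (c q) ^ (q - 2 - m))
      * (\<Prod>q = 1..N. ?i (c q) ^ min (q - 1) (N + 1 - q))) = (\<Prod>q = 1..N. c q ^ (l + 1 + 1 - q))"
    and b_prod: "(\<Prod>q = 1..N. b q) ^ (m + 1) * ((\<Prod>q = 1..N. ?i (b q) ^ (m + 1 - q))
      * (\<Prod>q = 1..N. ?i (b q) ^ min q (N - q))) = (\<Prod>q = 1..N. b q ^ (q - (l + 1)))"
    and d_prod: "(\<Prod>q = 1..N. d q) ^ (l + 1) * ((\<Prod>q = 1..N. ?i (d q) ^ (l + 1 - q))
      * (\<Prod>q = 1..N. ?i (d q) ^ min q (N - q))) = (\<Prod>q = 1..N. d q ^ (q - (m + 1)))"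
    unfolding prod_power_distrib prod.distrib[symmetric] power_add[symmetric]
    using nz(1-4) ml by (intro prod.cong power_cancel_inverse; force simp: N_def)+
  \<comment> \<open>Here \<open>S\<close> counts the factors \<open>1/2\<close> in the new weights
    and \<open>M\<close> the factors \<open>1/4\<close> in the \<open>\<Delta> q\<close>.\<close>
  have two: "2 ^ (N * (m + 1)) * 2 ^ (N * (l + 1)) * 2 ^ (m * (l + 1)) * ?i 2 ^ S * ?i 4 ^ M =
      2 ^ ((m + 1) * (l + 1 + 1))"
  proof -
    have "M = (m + 1) * (l + 1)"
      using sum_min_reflect[of "l + 1" "m + 1"] ml unfolding M_def
      by (simp add: N_def atLeastLessThanSuc_atLeastAtMost)
    moreover have "2 * S = 2 * (m * (m + 1)) + 2 * (l * (l + 1))"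
      using sum_descending[of m l] sum_ascending[of m l] sum_descending[of l m] sum_ascending[of l m]
      unfolding S_def by (simp add: add.commute[of l m])
    ultimately have "N * (m + 1) + N * (l + 1) + m * (l + 1) = (S + 2 * M) + (m + 1) * (l + 1 + 1)"
      by (simp add: N_def algebra_simps)
    then have "(2 :: 'w) ^ (N * (m + 1) + N * (l + 1) + m * (l + 1)) * ?i 2 ^ (S + 2 * M) =
        2 ^ ((m + 1) * (l + 1 + 1))"
      by (intro power_cancel_inverse) auto
    moreover have "?i 4 = ?i 2 ^ 2"
      by (simp add: power_inverse power_divide)
    ultimately show ?thesis
      by (simp only: power_add power_mult mult.assoc)
  qed
  have N: "m + 1 + (l + 1) = N" "m + l + 2 = N"
    by (simp_all add: N_def)
  have pre: "(\<Prod>q = 1..N. 2 * f q * g q) ^ x = 2 ^ (N * x) * (\<Prod>q = 1..N. f q) ^ x * (\<Prod>q = 1..N. g q) ^ x"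
    for f g :: "nat \<Rightarrow> 'w" and x
    by (simp add: prod.distrib power_mult_distrib power_mult)
  have xl: "m \<le> m + l" "l \<le> m + l"
    by simp_all
  have pow4: "?i 2 ^ S = ?i 2 ^ (\<Sum>q = 1..m + l. m + 1 - q) * ?i 2 ^ (\<Sum>q = 1..m + l. q - l)
      * ?i 2 ^ (\<Sum>q = 1..m + l. l + 1 - q) * ?i 2 ^ (\<Sum>q = 1..m + l. q - m)"
    unfolding S_def power_add ..
  \<comment> \<open>\<open>?K\<close> gathers everything on the left except the powers of
    \<open>\<Delta>\<close>. Multiplying the \<open>\<Delta>\<close> identity by it leaves a mere
    rearrangement of factors.\<close>
  let ?K = "2 ^ (N * (m + 1)) * 2 ^ (N * (l + 1)) * 2 ^ (m * (l + 1))
    * (?i 2 ^ (\<Sum>q = 1..m + l. m + 1 - q) * ?i 2 ^ (\<Sum>q = 1..m + l. q - l)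
      * ?i 2 ^ (\<Sum>q = 1..m + l. l + 1 - q) * ?i 2 ^ (\<Sum>q = 1..m + l. q - m))
    * (\<Prod>q = 1..N. a q) ^ (m + 1) * (\<Prod>q = 1..N. b q) ^ (m + 1)
    * (\<Prod>q = 1..N. c q) ^ (l + 1) * (\<Prod>q = 1..N. d q) ^ (l + 1)
    * (\<Prod>q = 1..N. ?i (a q) ^ (q - 2 - l)) * (\<Prod>q = 1..N. ?i (b q) ^ (m + 1 - q))
    * (\<Prod>q = 1..N. ?i (c q) ^ (q - 2 - m)) * (\<Prod>q = 1..N. ?i (d q) ^ (l + 1 - q))"
  show ?thesis
    using arg_cong[OF trans[OF \<Delta>_prod \<Delta>_split], of "(*) ?K"]
    unfolding N pre
    unfolding closed_form_def N prod.distrib desc[OF xl(1)] desc[OF xl(2)] asc mid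
      D_def[symmetric] two[symmetric] a_prod[symmetric] b_prod[symmetric] c_prod[symmetric] d_prod[symmetric]
      pow4
    by (simp only: mult_ac)
qed

section \<open>From \<open>closed_form\<close> to the products of the theorem\<close>

lemma prod_power_descending:
  fixes f :: "nat \<Rightarrow> 'w :: comm_semiring_1"
  assumes "x \<le> y" "y \<le> n"
  shows "(\<Prod>q = 1..n. f q ^ (x + 1 - q)) = (\<Prod>i = 1..y. f i ^ (x + 1 - i))"
  using assms by (intro prod.mono_neutral_right) auto

lemma prod_power_ascending:
  fixes f :: "nat \<Rightarrow> 'w :: comm_semiring_1"
  assumes "x \<le> y" "y \<le> n" "n = x + z"
  shows "(\<Prod>q = 1..n. f q ^ (q - z)) = (\<Prod>i = 1..y. f (n + 1 - i) ^ (x + 1 - i))"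
proof -
  have "(\<Prod>q = 1..n. f q ^ (q - z)) = (\<Prod>i = 1..n. f (n + 1 - i) ^ (x + 1 - i))"
    using assms by (subst prod.atLeastAtMost_rev) (auto intro!: prod.cong)
  also have "\<dots> = (\<Prod>i = 1..y. f (n + 1 - i) ^ (x + 1 - i))"
    using assms by (intro prod.mono_neutral_right) auto
  finally show ?thesis .
qed

text \<open>After exchanging the products, \<open>f i\<close> occurs once for each \<open>j\<close>
  with \<open>j \<le> i \<le> n - j\<close>, that is \<open>min i (n - i)\<close> times.\<close>

lemma prod_triangle:
  fixes f :: "nat \<Rightarrow> 'w :: comm_semiring_1"
  assumes "l = n div 2"
  shows "(\<Prod>j = 1..l. \<Prod>i = j..n - j. f i) = (\<Prod>i = 1..<n. f i ^ min i (n - i))"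
proof -
  have "(\<Prod>j = 1..l. \<Prod>i = j..n - j. f i) =
      (\<Prod>j = 1..l. \<Prod>i = 1..<n. if j \<le> min i (n - i) then f i else 1)"
  proof (rule prod.cong)
    fix j assume "j \<in> {1..l}"
    then have "{j..n - j} = {i \<in> {1..<n}. j \<le> min i (n - i)}"
      using assms by auto
    then show "(\<Prod>i = j..n - j. f i) = (\<Prod>i = 1..<n. if j \<le> min i (n - i) then f i else 1)"
      by (simp only: prod.inter_filter[OF finite_atLeastLessThan])
  qed simp
  also have "\<dots> = (\<Prod>i = 1..<n. \<Prod>j = 1..l. if j \<le> min i (n - i) then f i else 1)"
    by (rule prod.swap)
  also have "\<dots> = (\<Prod>i = 1..<n. f i ^ min i (n - i))"
  proof (rule prod.cong)
    fix i assume "i \<in> {1..<n}"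
    then have "{j \<in> {1..l}. j \<le> min i (n - i)} = {1..min i (n - i)}"
      using assms by auto
    then show "(\<Prod>j = 1..l. if j \<le> min i (n - i) then f i else 1) = f i ^ min i (n - i)"
      by (simp only: prod.inter_filter[OF finite_atLeastAtMost, symmetric] prod_constant) simp
  qed simp
  finally show ?thesis .
qed

lemma closed_form_even:
  fixes a b c d :: "nat \<Rightarrow> 'w :: field"
  assumes "n = 2 * k"
  shows "closed_form k k a b c d = 2 ^ (k * (k + 1))
    * (\<Prod>i = 1..k. (a i * b (n + 1 - i) * c i * d (n + 1 - i)) ^ (k + 1 - i))
    * (\<Prod>j = 1..k. \<Prod>i = j..n - j. d i * a (i + 1) + b i * c (i + 1))"
proof -
  have n: "k + k = n"
    using assms by simp
  have tri: "(\<Prod>j = 1..k. \<Prod>i = j..n - j. d i * a (i + 1) + b i * c (i + 1)) =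
      (\<Prod>i = 1..<n. (d i * a (i + 1) + b i * c (i + 1)) ^ min i (n - i))"
    using assms by (intro prod_triangle) simp
  have desc: "(\<Prod>q = 1..n. f q ^ (k + 1 - q)) = (\<Prod>i = 1..k. f i ^ (k + 1 - i))"
    for f :: "nat \<Rightarrow> 'w"
    using assms by (intro prod_power_descending) auto
  have asc: "(\<Prod>q = 1..n. f q ^ (q - k)) = (\<Prod>i = 1..k. f (n + 1 - i) ^ (k + 1 - i))"
    for f :: "nat \<Rightarrow> 'w"
    using assms by (intro prod_power_ascending) auto
  show ?thesis
    unfolding closed_form_def n prod.distrib desc asc tri power_mult_distrib
    by (simp only: mult_ac)
qed

lemma closed_form_odd:
  fixes a b c d :: "nat \<Rightarrow> 'w :: field"
  assumes "n = 2 * k + 1"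
  shows "closed_form (k + 1) k a b c d = 2 ^ ((k + 1) ^ 2)
    * (\<Prod>i = 1..k + 1. (a i * b (n + 1 - i)) ^ (k + 2 - i) * (c i * d (n + 1 - i)) ^ (k + 1 - i))
    * (\<Prod>j = 1..k. \<Prod>i = j..n - j. d i * a (i + 1) + b i * c (i + 1))"
proof -
  have n: "k + 1 + k = n" and k2: "k + 1 + 1 = k + 2"
    using assms by simp_all
  have tri: "(\<Prod>j = 1..k. \<Prod>i = j..n - j. d i * a (i + 1) + b i * c (i + 1)) =
      (\<Prod>i = 1..<n. (d i * a (i + 1) + b i * c (i + 1)) ^ min i (n - i))"
    using assms by (intro prod_triangle) simp
  have desc: "(\<Prod>q = 1..n. f q ^ (k + 2 - q)) = (\<Prod>i = 1..k + 1. f i ^ (k + 2 - i))"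
    "(\<Prod>q = 1..n. f q ^ (k + 1 - q)) = (\<Prod>i = 1..k + 1. f i ^ (k + 1 - i))"
    for f :: "nat \<Rightarrow> 'w"
    using assms prod_power_descending[of "k + 1" "k + 1" n f] prod_power_descending[of k "k + 1" n f]
    by auto
  have asc: "(\<Prod>q = 1..n. f q ^ (q - k)) = (\<Prod>i = 1..k + 1. f (n + 1 - i) ^ (k + 2 - i))"
    "(\<Prod>q = 1..n. f q ^ (q - (k + 1))) = (\<Prod>i = 1..k + 1. f (n + 1 - i) ^ (k + 1 - i))"
    for f :: "nat \<Rightarrow> 'w"
    using assms prod_power_ascending[of "k + 1" "k + 1" n k f]
      prod_power_ascending[of k "k + 1" n "k + 1" f]
    by auto
  show ?thesis
    unfolding closed_form_def n k2 prod.distrib desc asc tri power_mult_distrib power2_eq_square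
    by (simp only: mult_ac)
qed

section \<open>The four-row weights\<close>

lemma prod_parity:
  fixes x y :: "'w :: comm_semiring_1"
  shows "(\<Prod>p = 1..N. if odd p then x else y) = x ^ ((N + 1) div 2) * y ^ (N div 2)"
  by (induction N) (auto simp: mult_ac)

text \<open>The four-row pattern without reference to the order, so that one family of weights
  serves every stage of the induction.\<close>

fun row_weight :: "(nat \<Rightarrow> 'w) \<Rightarrow> (nat \<Rightarrow> 'w) \<Rightarrow> (nat \<Rightarrow> 'w) \<Rightarrow> (nat \<Rightarrow> 'w) \<Rightarrow> nat \<times> nat \<Rightarrow> 'w" where
  "row_weight a b c d (r, s) =
     (if odd ((r + 1) div 2)
      then (if odd s then a ((s + 1) div 2) else b ((s + 1) div 2))
      else (if odd s then c ((s + 1) div 2) else d ((s + 1) div 2)))"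

text \<open>
  One reduction shifts the \<open>2 \<times> 2\<close> blocks by one row and one column, so the row period now reads
  \<open>ab, cd, cd, ab\<close> and a block combines columns \<open>q\<close> and \<open>q + 1\<close>.
\<close>

fun shifted_weight :: "(nat \<Rightarrow> 'w :: field) \<Rightarrow> (nat \<Rightarrow> 'w) \<Rightarrow> (nat \<Rightarrow> 'w) \<Rightarrow> (nat \<Rightarrow> 'w) \<Rightarrow> nat \<times> nat \<Rightarrow> 'w" where
  "shifted_weight a b c d (r, s) =
     (if even (r div 2)
      then inverse (2 * (if odd s then b ((s + 1) div 2) else a (s div 2 + 1)))
      else inverse (2 * (if odd s then d ((s + 1) div 2) else c (s div 2 + 1))))"

text \<open>The matrix has as many columns as the edge array, so only the row index wraps
  around.\<close>

lemma matching_sum_aztec_diamond: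
  assumes "n \<ge> 1"
  shows "matching_sum (aztec_diamond n (weight_matrix n a b c d)) =
    matching_sum (aztec n (row_weight a b c d))"
proof -
  have "matching_sum (aztec_diamond n (weight_matrix n a b c d)) =
      matching_sum (aztec n (periodic_weight (weight_matrix n a b c d)))"
    by (simp add: aztec_diamond_def aztec_def)
  also have "\<dots> = matching_sum (aztec n (row_weight a b c d))"
  proof (rule matching_sum_aztec_cong)
    fix r s :: nat
    assume s: "r \<in> {1..2 * n}" "s \<in> {1..2 * n}"
    then have "s - 1 < 2 * n"
      by auto
    then have *: "periodic_weight (weight_matrix n a b c d) (r, s) =
        (if (r - 1) mod 4 < 2
         then (if even (s - 1) then a ((s - 1) div 2 + 1) else b ((s - 1) div 2 + 1))
         else (if even (s - 1) then c ((s - 1) div 2 + 1) else d ((s - 1) div 2 + 1)))"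
      by (simp add: weight_matrix_def)
    have s': "(s - 1) div 2 + 1 = (s + 1) div 2" "even (s - 1) \<longleftrightarrow> odd s"
      using s by auto
    have "t mod 4 < 2 \<longleftrightarrow> odd ((t + 2) div 2)" for t :: nat
      by presburger
    moreover have "r - 1 + 2 = r + 1"
      using s by simp
    ultimately have r': "(r - 1) mod 4 < 2 \<longleftrightarrow> odd ((r + 1) div 2)"
      by metis
    show "periodic_weight (weight_matrix n a b c d) (r, s) = row_weight a b c d (r, s)"
      unfolding * s' r' row_weight.simps ..
  qed
  finally show ?thesis .
qed

lemma double_div_2:
  fixes q :: nat
  assumes "q \<ge> 1"
  shows "odd (2 * q - 1)" "(2 * q - 1 + 1) div 2 = q" "(2 * q + 1) div 2 = q" "2 * q div 2 = q"
    "even ((2 * q - 1) div 2) \<longleftrightarrow> odd q"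
  using assms by presburger+

text \<open>Both rows of a cell carry the same weights, so its two perfect matchings weigh the
  same.\<close>

lemma cell_factor_row_weight:
  assumes "p \<ge> 1" "q \<ge> 1"
  shows "cell_factor (row_weight a b c d) (p, q) =
    (if odd p then 2 * a q * b q else 2 * c q * d q)"
  unfolding cell_factor.simps row_weight.simps double_div_2[OF assms(1)] double_div_2[OF assms(2)]
  using assms(2) by (simp add: mult_2[symmetric] mult_ac)

text \<open>Every cell now contains one \<open>ab\<close> row and one \<open>cd\<close> row. Their
  order depends on the parity of \<open>p\<close>, but the sum over the two matchings does
  not.\<close>

lemma cell_factor_shifted_weight:
  assumes "p \<ge> 1" "q \<ge> 1"
  shows "cell_factor (shifted_weight a b c d) (p, q) =
    inverse (2 * b q) * inverse (2 * c (q + 1)) + inverse (2 * a (q + 1)) * inverse (2 * d q)"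
  unfolding cell_factor.simps shifted_weight.simps double_div_2[OF assms(1)] double_div_2[OF assms(2)]
  using assms(2) by (simp add: mult.commute add.commute)

lemma mirror_Suc: "mirror (r + 1) = (if even r then r + 2 else r)"
  by (simp add: mirror_def)

lemma mirror_div_2:
  "odd ((mirror (r + 1) + 1) div 2) \<longleftrightarrow> even (r div 2)"
  "even (mirror (r + 1) div 2) \<longleftrightarrow> odd ((r + 1) div 2)"
  unfolding mirror_Suc by (auto elim!: evenE oddE)

text \<open>Opposite an \<open>a\<close> edge lies a \<open>b\<close> edge, so its dual weight is
  \<open>b / (2 * a * b)\<close>, the inverse of \<open>2 * a\<close>; the other three kinds are
  alike.\<close>

lemma reduced_row_weight:
  assumes rs: "r \<ge> 1" "s \<ge> 1"
    and nz: "\<And>q. q = s div 2 + 1 \<or> q = (s + 1) div 2 \<Longrightarrow> a q \<noteq> 0 \<and> b q \<noteq> 0 \<and> c q \<noteq> 0 \<and> d q \<noteq> 0"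
  shows "reduced_weight (row_weight a b c d) (r, s) = shifted_weight a b c d (r, s)"
proof -
  have f: "cell_factor (row_weight a b c d) ((r + 2) div 2, (s + 2) div 2) =
      (if odd ((r + 2) div 2) then 2 * a ((s + 2) div 2) * b ((s + 2) div 2)
       else 2 * c ((s + 2) div 2) * d ((s + 2) div 2))"
    using rs by (intro cell_factor_row_weight) auto
  have "odd ((r + 2) div 2) \<longleftrightarrow> even (r div 2)"
    by simp
  note r = this mirror_div_2(1)[of r]
  have w: "reduced_weight (row_weight a b c d) (r, s) =
      row_weight a b c d (mirror (r + 1), mirror (s + 1)) /
        cell_factor (row_weight a b c d) ((r + 2) div 2, (s + 2) div 2)"
    by (simp add: reduced_weight_def)
  show ?thesis
  proof (cases "odd s")
    case True
    then have "mirror (s + 1) = s" "(s + 2) div 2 = (s + 1) div 2"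
      by (auto simp: mirror_def)
    then show ?thesis
      using True nz[of "(s + 1) div 2"] unfolding w f r row_weight.simps shifted_weight.simps
      by (simp add: field_simps)
  next
    case False
    then have "mirror (s + 1) = s + 2" "(s + 2) div 2 = s div 2 + 1" "(s + 2 + 1) div 2 = s div 2 + 1"
      by (auto simp: mirror_def)
    then show ?thesis
      using False nz[of "s div 2 + 1"] unfolding w f r row_weight.simps shifted_weight.simps
      by (simp add: field_simps)
  qed
qed

text \<open>The second reduction restores the row pattern. The index \<open>q + 2\<close> arises
  because column \<open>2 * q\<close> comes from cell column \<open>q + 1\<close>, where the
  opposite edges carry \<open>a (q + 2)\<close> or \<open>c (q + 2)\<close>.\<close>

lemma reduced_shifted_weight:
  assumes rs: "r \<ge> 1" "s \<ge> 1"
    and \<Delta>: "\<And>q. \<Delta> q = inverse (2 * b q) * inverse (2 * c (q + 1)) + inverse (2 * a (q + 1)) * inverse (2 * d q)"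
  shows "reduced_weight (shifted_weight a b c d) (r, s) =
    row_weight (\<lambda>q. inverse (2 * b q * \<Delta> q)) (\<lambda>q. inverse (2 * a (q + 2) * \<Delta> (q + 1)))
      (\<lambda>q. inverse (2 * d q * \<Delta> q)) (\<lambda>q. inverse (2 * c (q + 2) * \<Delta> (q + 1))) (r, s)"
proof -
  have f: "cell_factor (shifted_weight a b c d) ((r + 2) div 2, (s + 2) div 2) = \<Delta> ((s + 2) div 2)"
    unfolding \<Delta> using rs by (intro cell_factor_shifted_weight) auto
  note r = mirror_div_2(2)[of r]
  have w: "reduced_weight (shifted_weight a b c d) (r, s) =
      shifted_weight a b c d (mirror (r + 1), mirror (s + 1)) /
        cell_factor (shifted_weight a b c d) ((r + 2) div 2, (s + 2) div 2)"
    by (simp add: reduced_weight_def)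
  show ?thesis
  proof (cases "odd s")
    case True
    then have h: "mirror (s + 1) = s" "(s + 2) div 2 = (s + 1) div 2"
      by (simp_all add: mirror_def)
    show ?thesis
      unfolding w f unfolding h row_weight.simps shifted_weight.simps r
      by (cases "odd ((r + 1) div 2)") (simp_all only: True if_True if_False divide_inverse inverse_mult_distrib simp_thms)
  next
    case False
    then have h: "mirror (s + 1) = s + 2" "(s + 2) div 2 = s div 2 + 1" "(s + 1) div 2 = s div 2"
      "s div 2 + 1 + 1 = s div 2 + 2" "odd (s + 2) \<longleftrightarrow> odd s"
      by (simp_all add: mirror_def)
    show ?thesis
      unfolding w f unfolding h row_weight.simps shifted_weight.simps r
      by (cases "odd ((r + 1) div 2)") (simp_all only: False if_True if_False divide_inverse inverse_mult_distrib simp_thms)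
  qed
qed

text \<open>Induction in steps of two, since two reductions return to the four-row pattern.
  Positivity keeps all cell factors nonzero and passes to the new weights.\<close>

lemma matching_sum_row_weight:
  fixes a b c d :: "nat \<Rightarrow> real"
  assumes "\<And>i. i \<in> {1..n} \<Longrightarrow> a i > 0" "\<And>i. i \<in> {1..n} \<Longrightarrow> b i > 0"
    "\<And>i. i \<in> {1..n} \<Longrightarrow> c i > 0" "\<And>i. i \<in> {1..n} \<Longrightarrow> d i > 0"
  shows "matching_sum (aztec n (row_weight a b c d)) =
    closed_form ((n + 1) div 2) (n div 2) a b c d"
  using assms
proof (induction n arbitrary: a b c d rule: less_induct)
  case (less N)
  have cell_pos: "cell_factor (row_weight a b c d) (p, q) > 0"
    if "p \<in> {1..N}" "q \<in> {1..N}" for p q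
    using that less.prems by (simp add: cell_factor_row_weight del: cell_factor.simps)
  consider "N = 0" | "N = 1" | n where "N = n + 2"
    by (metis One_nat_def add_2_eq_Suc' not0_implies_Suc)
  then show ?case
  proof cases
    case 1
    then show ?thesis
      by (simp add: matching_sum_aztec_0 closed_form_def)
  next
    case 2
    have "matching_sum (aztec (Suc 0) (row_weight a b c d)) = cell_factor (row_weight a b c d) (1, 1)"
      using cell_pos[of 1 1] 2 by (subst aztec_reduction) (auto simp: matching_sum_aztec_0)
    then show ?thesis
      using 2 by (simp add: closed_form_def cell_factor_row_weight del: cell_factor.simps)
  next
    case (3 n)
    define \<Delta> where "\<Delta> q = inverse (2 * b q) * inverse (2 * c (q + 1))
      + inverse (2 * a (q + 1)) * inverse (2 * d q)" for q
    \<comment> \<open>Among the \<open>n + 2\<close> rows of cells, \<open>m + 1\<close> have odd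
      and \<open>l + 1\<close> have even number.\<close>
    define m l where "m = (n + 1) div 2" and "l = n div 2"
    have ml: "l \<le> m" "m \<le> l + 1" "m + l = n"
      by (auto simp: m_def l_def)
    have pos: "a q > 0" "b q > 0" "c q > 0" "d q > 0" if "q \<in> {1..n + 2}" for q
      using less.prems 3 that by auto
    have \<Delta>_pos: "\<Delta> q > 0" if "q \<in> {1..n + 1}" for q
      using pos[of q] pos[of "q + 1"] that by (simp add: \<Delta>_def add_pos_pos)
    let ?a = "\<lambda>q. inverse (2 * b q * \<Delta> q)" and ?b = "\<lambda>q. inverse (2 * a (q + 2) * \<Delta> (q + 1))"
    let ?c = "\<lambda>q. inverse (2 * d q * \<Delta> q)" and ?d = "\<lambda>q. inverse (2 * c (q + 2) * \<Delta> (q + 1))"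
    have first: "(\<Prod>e\<in>{1..n + 2} \<times> {1..n + 2}. cell_factor (row_weight a b c d) e) =
        (\<Prod>q = 1..n + 2. 2 * a q * b q) ^ (m + 1) * (\<Prod>q = 1..n + 2. 2 * c q * d q) ^ (l + 1)"
    proof -
      have "(\<Prod>e\<in>{1..n + 2} \<times> {1..n + 2}. cell_factor (row_weight a b c d) e) =
          (\<Prod>p = 1..n + 2. \<Prod>q = 1..n + 2. cell_factor (row_weight a b c d) (p, q))"
        by (simp only: prod.cartesian_product case_prod_eta)
      also have "\<dots> = (\<Prod>p = 1..n + 2. if odd p then \<Prod>q = 1..n + 2. 2 * a q * b q
          else \<Prod>q = 1..n + 2. 2 * c q * d q)"
      proof (rule prod.cong[OF refl])
        fix p assume p: "p \<in> {1..n + 2}"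
        have "(\<Prod>q = 1..n + 2. cell_factor (row_weight a b c d) (p, q)) =
            (\<Prod>q = 1..n + 2. if odd p then 2 * a q * b q else 2 * c q * d q)"
          using p by (intro prod.cong refl cell_factor_row_weight) auto
        then show "(\<Prod>q = 1..n + 2. cell_factor (row_weight a b c d) (p, q)) =
            (if odd p then \<Prod>q = 1..n + 2. 2 * a q * b q else \<Prod>q = 1..n + 2. 2 * c q * d q)"
          by (cases "odd p") (simp_all only: if_True if_False simp_thms)
      qed
      also have "\<dots> = (\<Prod>q = 1..n + 2. 2 * a q * b q) ^ ((n + 2 + 1) div 2)
          * (\<Prod>q = 1..n + 2. 2 * c q * d q) ^ ((n + 2) div 2)"
        by (rule prod_parity)
      also have "(n + 2 + 1) div 2 = m + 1"
        by (simp add: m_def)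
      also have "(n + 2) div 2 = l + 1"
        by (simp add: l_def)
      finally show ?thesis .
    qed
    have second: "(\<Prod>e\<in>{1..n + 1} \<times> {1..n + 1}. cell_factor (shifted_weight a b c d) e) =
        (\<Prod>q = 1..n + 1. \<Delta> q) ^ (n + 1)"
    proof -
      have "(\<Prod>e\<in>{1..n + 1} \<times> {1..n + 1}. cell_factor (shifted_weight a b c d) e) =
          (\<Prod>p = 1..n + 1. \<Prod>q = 1..n + 1. cell_factor (shifted_weight a b c d) (p, q))"
        by (simp only: prod.cartesian_product case_prod_eta)
      also have "\<dots> = (\<Prod>p = 1..n + 1. \<Prod>q = 1..n + 1. \<Delta> q)"
        unfolding \<Delta>_def by (intro prod.cong refl cell_factor_shifted_weight) auto
      also have "\<dots> = (\<Prod>q = 1..n + 1. \<Delta> q) ^ (n + 1)"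
        by (simp only: prod_constant card_atLeastAtMost) simp
      finally show ?thesis .
    qed
    have R: "n + 2 = Suc (n + 1)" "n + 1 = Suc n"
      by simp_all
    have "matching_sum (aztec N (row_weight a b c d)) =
        (\<Prod>e\<in>{1..n + 2} \<times> {1..n + 2}. cell_factor (row_weight a b c d) e)
        * matching_sum (aztec (n + 1) (reduced_weight (row_weight a b c d)))"
      unfolding 3 R(1)
    proof (rule aztec_reduction)
      show "cell_factor (row_weight a b c d) (p, q) \<noteq> 0" if "p \<in> {1..Suc (n + 1)}" "q \<in> {1..Suc (n + 1)}" for p q
        using cell_pos[of p q] that by (simp only: 3 R(1)) (simp del: cell_factor.simps)
    qed
    also have "matching_sum (aztec (n + 1) (reduced_weight (row_weight a b c d))) =
        matching_sum (aztec (n + 1) (shifted_weight a b c d))"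
    proof (rule matching_sum_aztec_cong, rule reduced_row_weight)
      fix r s q assume "r \<in> {1..2 * (n + 1)}" "s \<in> {1..2 * (n + 1)}" "q = s div 2 + 1 \<or> q = (s + 1) div 2"
      then have "q \<in> {1..n + 2}"
        by auto
      then show "a q \<noteq> 0 \<and> b q \<noteq> 0 \<and> c q \<noteq> 0 \<and> d q \<noteq> 0"
        using pos[of q] by auto
    qed auto
    also have "matching_sum (aztec (n + 1) (shifted_weight a b c d)) =
        (\<Prod>e\<in>{1..n + 1} \<times> {1..n + 1}. cell_factor (shifted_weight a b c d) e)
        * matching_sum (aztec n (reduced_weight (shifted_weight a b c d)))"
    proof -
      have "cell_factor (shifted_weight a b c d) (p, q) \<noteq> 0" if "p \<in> {1..Suc n}" "q \<in> {1..Suc n}" for p q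
        using \<Delta>_pos[of q] that by (subst cell_factor_shifted_weight) (auto simp: \<Delta>_def)
      then show ?thesis
        unfolding R(2) by (rule aztec_reduction)
    qed
    also have "matching_sum (aztec n (reduced_weight (shifted_weight a b c d))) =
        matching_sum (aztec n (row_weight ?a ?b ?c ?d))"
      by (rule matching_sum_aztec_cong, rule reduced_shifted_weight) (auto simp: \<Delta>_def)
    \<comment> \<open>For \<open>q \<le> n\<close> the new weights use the old ones up to index
      \<open>q + 2\<close> and \<open>\<Delta>\<close> up to \<open>q + 1\<close>, within the ranges
      where positivity is known.\<close>
    also have "\<dots> = closed_form m l ?a ?b ?c ?d"
      unfolding m_def l_def using 3 pos \<Delta>_pos by (intro less.IH) auto
    finally have "matching_sum (aztec N (row_weight a b c d)) =
        (\<Prod>q = 1..n + 2. 2 * a q * b q) ^ (m + 1) * (\<Prod>q = 1..n + 2. 2 * c q * d q) ^ (l + 1)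
        * (\<Prod>q = 1..n + 1. \<Delta> q) ^ (n + 1) * closed_form m l ?a ?b ?c ?d"
      unfolding first second by (simp only: mult.assoc)
    also have "\<dots> = closed_form (m + 1) (l + 1) a b c d"
      unfolding ml(3)[symmetric]
      using ml pos \<Delta>_pos by (intro closed_form_step) (auto simp: \<Delta>_def less_imp_neq[THEN not_sym])
    finally show ?thesis
      by (simp add: 3 m_def l_def)
  qed
qed

theorem theorem3p4:
  fixes n :: nat and a b c d :: "nat \<Rightarrow> real"
  assumes "n \<ge> 1"
    and "\<And>i. i \<in> {1..n} \<Longrightarrow> a i > 0"
    and "\<And>i. i \<in> {1..n} \<Longrightarrow> b i > 0"
    and "\<And>i. i \<in> {1..n} \<Longrightarrow> c i > 0"
    and "\<And>i. i \<in> {1..n} \<Longrightarrow> d i > 0"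
  shows "(\<forall>k. n = 2 * k \<longrightarrow>
            matching_sum (aztec_diamond n (weight_matrix n a b c d)) =
              2 ^ (k * (k + 1))
              * (\<Prod>i = 1..k. (a i * b (n + 1 - i) * c i * d (n + 1 - i)) ^ (k + 1 - i))
              * (\<Prod>j = 1..k. \<Prod>i = j..n - j. d i * a (i + 1) + b i * c (i + 1))) \<and>
         (\<forall>k. n = 2 * k + 1 \<longrightarrow>
            matching_sum (aztec_diamond n (weight_matrix n a b c d)) =
              2 ^ ((k + 1) ^ 2)
              * (\<Prod>i = 1..k + 1. (a i * b (n + 1 - i)) ^ (k + 2 - i)
                                * (c i * d (n + 1 - i)) ^ (k + 1 - i))
              * (\<Prod>j = 1..k. \<Prod>i = j..n - j. d i * a (i + 1) + b i * c (i + 1)))"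
proof -
  have *: "matching_sum (aztec_diamond n (weight_matrix n a b c d)) =
      closed_form ((n + 1) div 2) (n div 2) a b c d"
    using assms(2-5)
    by (intro trans[OF matching_sum_aztec_diamond[OF assms(1)] matching_sum_row_weight]) auto
  show ?thesis
  proof (intro conjI allI impI)
    fix k assume k: "n = 2 * k"
    then have "(n + 1) div 2 = k" "n div 2 = k"
      by simp_all
    then show "matching_sum (aztec_diamond n (weight_matrix n a b c d)) =
        2 ^ (k * (k + 1))
        * (\<Prod>i = 1..k. (a i * b (n + 1 - i) * c i * d (n + 1 - i)) ^ (k + 1 - i))
        * (\<Prod>j = 1..k. \<Prod>i = j..n - j. d i * a (i + 1) + b i * c (i + 1))"
      unfolding * by (simp only: closed_form_even[OF k])
  next
    fix k assume k: "n = 2 * k + 1"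
    then have "(n + 1) div 2 = k + 1" "n div 2 = k"
      by simp_all
    then show "matching_sum (aztec_diamond n (weight_matrix n a b c d)) =
        2 ^ ((k + 1) ^ 2)
        * (\<Prod>i = 1..k + 1. (a i * b (n + 1 - i)) ^ (k + 2 - i) * (c i * d (n + 1 - i)) ^ (k + 1 - i))
        * (\<Prod>j = 1..k. \<Prod>i = j..n - j. d i * a (i + 1) + b i * c (i + 1))"
      unfolding * by (simp only: closed_form_odd[OF k])
  qed
qed

end
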